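(* Let $1<p<\infty$, let $T\in\mathcal L(\ell_p)$ and let $\lambda\in\mathbb C$. Then the following conditions are equivalent. (i) $\lambda\in W_e(T)$. (ii) For every $k\in\mathbb N$ and every $\varepsilon>0$ there exists a unit vector $x\in\ell_p$ with finite support such that $\operatorname{supp}x\subset\{k+1,k+2,\dots\}$ and $|\langle Tx,J(x)\rangle-\lambda|<\varepsilon$. (iii) For all subspaces $M,F\subset\ell_p$ with $\operatorname{codim}M<\infty$ and $\dim F<\infty$, and for every $\varepsilon>0$, there exists a unit vector $x\in M$ with finite support such that $$|\langle Tx,J(x)\rangle-\lambda|<\varepsilon,\qquad \sup\{|\langle f,J(x)\rangle|:\ f\in F,\ \|f\|=1\}<\varepsilon.$$
   Context: $\ell_p=\ell_p(\mathbb N)$ is the complex sequence space, $\mathcal L(\ell_p)$ its algebra of bounded linear operators, and $\operatorname{supp}x=\{j:x_j\ne0\}$. Finite-codimensional subspaces are understood to be closed. With $1/p+1/q=1$, the dual $(\ell_p)^*$ is identified with $\ell_q$ via $\langle x,y\rangle=\sum_j x_j\overline{y_j}$. For $x=(x_j)\in\ell_p$ put $J(x)=(x_j|x_j|^{p-2})_j\in\ell_q$ (with $0$ in the coordinates where $x_j=0$). The essential numerical range $W_e(T)$ is the set of all $\lambda\in\mathbb C$ for which there is a net (equivalently, a sequence) of unit vectors $x_\alpha\in\ell_p$ with $x_\alpha\to0$ weakly and $\langle Tx_\alpha,J(x_\alpha)\rangle\to\lambda$. When $F=\{0\}$ the supremum in (iii) is taken to be $0$. *)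

theory Defs
  imports "HOL-Analysis.Analysis" "HOL-Library.Function_Algebras"
begin

text \<open>
  Since the exponent \<open>p\<close> is a real parameter, \<open>\<ell>\<^sub>p\<close> is a carrier set inside the complex vector space
  of all sequences \<open>nat \<Rightarrow> complex\<close>, with pointwise operations.
\<close>

definition cseq_scale :: "complex \<Rightarrow> (nat \<Rightarrow> complex) \<Rightarrow> nat \<Rightarrow> complex" where
  "cseq_scale c x = (\<lambda>j. c * x j)"

interpretation cseq: vector_space cseq_scale
  by unfold_locales (auto simp: cseq_scale_def fun_eq_iff algebra_simps)

definition lp_space :: "real \<Rightarrow> (nat \<Rightarrow> complex) set" where
  "lp_space p = {x. summable (\<lambda>j. norm (x j) powr p)}"

definition lp_norm :: "real \<Rightarrow> (nat \<Rightarrow> complex) \<Rightarrow> real" where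
  "lp_norm p x = (\<Sum>j. norm (x j) powr p) powr (1 / p)"

definition lp_dist :: "real \<Rightarrow> (nat \<Rightarrow> complex) \<Rightarrow> (nat \<Rightarrow> complex) \<Rightarrow> real" where
  "lp_dist p x y = lp_norm p (x - y)"

definition seq_supp :: "(nat \<Rightarrow> complex) \<Rightarrow> nat set" where
  "seq_supp x = {j. x j \<noteq> 0}"

definition pairing :: "(nat \<Rightarrow> complex) \<Rightarrow> (nat \<Rightarrow> complex) \<Rightarrow> complex" where
  "pairing x y = (\<Sum>j. x j * cnj (y j))"

definition duality_map :: "real \<Rightarrow> (nat \<Rightarrow> complex) \<Rightarrow> nat \<Rightarrow> complex" where
  "duality_map p x = (\<lambda>j. x j * complex_of_real (norm (x j) powr (p - 2)))"

text \<open>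
  Operators and functionals are functions on all sequences of which only the restriction to
  \<open>lp_space p\<close> matters.
\<close>

definition lp_operator :: "real \<Rightarrow> ((nat \<Rightarrow> complex) \<Rightarrow> (nat \<Rightarrow> complex)) \<Rightarrow> bool" where
  "lp_operator p T \<longleftrightarrow>
     (\<forall>x\<in>lp_space p. T x \<in> lp_space p) \<and>
     (\<forall>x\<in>lp_space p. \<forall>y\<in>lp_space p. T (x + y) = T x + T y) \<and>
     (\<forall>c. \<forall>x\<in>lp_space p. T (cseq_scale c x) = cseq_scale c (T x)) \<and>
     (\<exists>K. \<forall>x\<in>lp_space p. lp_norm p (T x) \<le> K * lp_norm p x)"

definition lp_dual :: "real \<Rightarrow> ((nat \<Rightarrow> complex) \<Rightarrow> complex) set" where
  "lp_dual p = {\<phi>.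
     (\<forall>x\<in>lp_space p. \<forall>y\<in>lp_space p. \<phi> (x + y) = \<phi> x + \<phi> y) \<and>
     (\<forall>c. \<forall>x\<in>lp_space p. \<phi> (cseq_scale c x) = c * \<phi> x) \<and>
     (\<exists>K. \<forall>x\<in>lp_space p. norm (\<phi> x) \<le> K * lp_norm p x)}"

definition lp_unit_sphere :: "real \<Rightarrow> (nat \<Rightarrow> complex) set" where
  "lp_unit_sphere p = {x \<in> lp_space p. lp_norm p x = 1}"

text \<open>
  A net of unit vectors is represented by the filter on the unit sphere generated by the images of
  its tails; this filter is proper, every proper filter arises in this way, and convergence of a
  function along the net is convergence along the filter. Sequences are the case
  \<open>N = filtermap x sequentially\<close>.
\<close>

definition ess_num_range :: "real \<Rightarrow> ((nat \<Rightarrow> complex) \<Rightarrow> (nat \<Rightarrow> complex)) \<Rightarrow> complex set" where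
  "ess_num_range p T = {l. \<exists>N :: (nat \<Rightarrow> complex) filter.
     N \<noteq> bot \<and> N \<le> principal (lp_unit_sphere p) \<and>
     (\<forall>\<phi>\<in>lp_dual p. (\<phi> \<longlongrightarrow> 0) N) \<and>
     ((\<lambda>x. pairing (T x) (duality_map p x)) \<longlongrightarrow> l) N}"

definition lp_fin_dim_subspace :: "real \<Rightarrow> (nat \<Rightarrow> complex) set \<Rightarrow> bool" where
  "lp_fin_dim_subspace p F \<longleftrightarrow>
     cseq.subspace F \<and> F \<subseteq> lp_space p \<and> (\<exists>B. finite B \<and> cseq.span B = F)"

text \<open>
  The last conjunct says that the quotient of \<open>lp_space p\<close> by \<open>M\<close> is spanned by finitely many
  cosets.
\<close>

definition lp_closed_fin_codim_subspace :: "real \<Rightarrow> (nat \<Rightarrow> complex) set \<Rightarrow> bool" where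
  "lp_closed_fin_codim_subspace p M \<longleftrightarrow>
     cseq.subspace M \<and> M \<subseteq> lp_space p \<and>
     closedin (Metric_space.mtopology (lp_space p) (lp_dist p)) M \<and>
     (\<exists>B. finite B \<and> cseq.span (M \<union> B) = lp_space p)"

text \<open>
  The case distinction is needed because the supremum of the empty set is unspecified on
  \<open>real\<close>.
\<close>

definition pairing_sup :: "real \<Rightarrow> (nat \<Rightarrow> complex) set \<Rightarrow> (nat \<Rightarrow> complex) \<Rightarrow> real" where
  "pairing_sup p F y =
     (if F = {0} then 0 else (SUP f\<in>{f \<in> F. lp_norm p f = 1}. norm (pairing f y)))"

end

theory Submission imports Defs begin

text \<open>
Write \<open>[x, y]\<close> for \<open>\<langle>x, J(y)\<rangle>\<close>; Hoelder's inequality gives \<open>\<bar>[x, y]\<bar> \<le> \<parallel>x\<parallel> \<parallel>y\<parallel>\<^sup>p\<^sup>-\<^sup>1\<close>. The map \<open>J\<close> is not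
additive, but it acts coordinatewise, so it is additive on vectors with pairwise disjoint supports,
and so is \<open>x \<mapsto> \<parallel>x\<parallel>\<^sup>p\<close>. The whole proof is arranged so that only such sums are ever put into the
second argument of \<open>[\<cdot>, \<cdot>]\<close>, which replaces any continuity estimate for \<open>J\<close>.

From (i) to (ii): a vector \<open>x\<close> far along the net has small initial coordinates, because coordinates
are functionals, and a small tail beyond some index. Hence \<open>x = v + r\<close> with \<open>v\<close> a finite block beyond
\<open>k\<close>, \<open>r\<close> small, and disjoint supports. Expanding \<open>[Tx, x]\<close> shows that the normalisation of \<open>v\<close> has
almost the same numerical value as \<open>x\<close> (\<open>normalized_block_bracket\<close>).

From (ii) to (i): unit blocks that move to infinity form a weakly null sequence. If a functional
\<open>\<phi>\<close> stayed above \<open>\<eta>\<close> in modulus on \<open>N\<close> disjoint blocks, then on a suitable sum of them, of norm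
\<open>N\<^sup>1\<^sup>/\<^sup>p\<close>, it would be at least \<open>N \<eta>\<close>, which is impossible for large \<open>N\<close> as \<open>p > 1\<close>
(\<open>functional_small_on_tails\<close>).

From (ii) to (iii): if \<open>M\<close> has codimension at most \<open>d\<close>, any \<open>d + 1\<close> vectors have a nontrivial
combination in \<open>M\<close> (\<open>combination_in_finite_codim_subspace\<close>). Take them to be disjoint unit blocks
\<open>u\<^sub>0, \<dots>, u\<^sub>d\<close> with \<open>[T u\<^sub>i, u\<^sub>i]\<close> close to \<open>\<lambda>\<close>, chosen one after the other so far out that
\<open>[T u\<^sub>i, u\<^sub>j]\<close> is tiny for \<open>i \<noteq> j\<close>: for \<open>i < j\<close> because \<open>T u\<^sub>i\<close> has small tails, for \<open>i > j\<close> because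
\<open>[T \<cdot>, u\<^sub>j]\<close> is a functional and hence small on far blocks. If \<open>y = \<Sum> b\<^sub>i u\<^sub>i\<close> is a unit vector, then
\<open>\<Sum> \<bar>b\<^sub>i\<bar>\<^sup>p = 1\<close>, and \<open>[Ty, y]\<close> differs from \<open>\<Sum> \<bar>b\<^sub>i\<bar>\<^sup>p [T u\<^sub>i, u\<^sub>i]\<close> only by the tiny off-diagonal terms
(\<open>bracket_block_combination\<close>). The pairing with \<open>F\<close> is small as soon as all blocks lie far out, since
the vectors of a finite-dimensional space have uniformly small tails
(\<open>finite_dim_coordinate_representation\<close>).

From (iii) to (ii): apply (iii) with \<open>M\<close> the space of vectors whose coordinates up to \<open>k\<close> vanish and
\<open>F = {0}\<close>.
\<close>

section \<open>Sequence spaces\<close>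

text \<open>
For members of the space this is \<open>\<parallel>x\<parallel>\<^sup>p\<close>. It is the better quantity to compute with, because it is
additive over disjoint supports.
\<close>

definition lp_modular :: "real \<Rightarrow> (nat \<Rightarrow> complex) \<Rightarrow> real" where
  "lp_modular p x = (\<Sum>j. norm (x j) powr p)"

text \<open>
Up to the factor \<open>\<parallel>y\<parallel>\<^sup>p\<^sup>-\<^sup>2\<close>, this is the semi-inner product of Lumer and Giles. It is linear in \<open>x\<close> and
only homogeneous of degree \<open>p - 1\<close> in \<open>y\<close>.
\<close>

abbreviation (input) bracket :: "real \<Rightarrow> (nat \<Rightarrow> complex) \<Rightarrow> (nat \<Rightarrow> complex) \<Rightarrow> complex" where
  "bracket p x y \<equiv> pairing x (duality_map p y)"

lemma cseq_scale_apply [simp]: "cseq_scale c x j = c * x j"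
  by (simp add: cseq_scale_def)

lemma sum_seq_apply: "(\<Sum>i\<in>I. u i) j = (\<Sum>i\<in>I. u i j)"
  for u :: "'i \<Rightarrow> nat \<Rightarrow> complex"
  by (induction I rule: infinite_finite_induct) auto

lemma lp_spaceD: "x \<in> lp_space p \<Longrightarrow> summable (\<lambda>j. norm (x j) powr p)"
  by (simp add: lp_space_def)

lemma lp_space_zero [simp]: "0 \<in> lp_space p"
  by (simp add: lp_space_def)

lemma lp_space_scale [simp]: "x \<in> lp_space p \<Longrightarrow> cseq_scale c x \<in> lp_space p"
  by (auto simp: lp_space_def norm_mult powr_mult intro: summable_mult)

lemma lp_space_dominated:
  assumes "x \<in> lp_space p" "0 \<le> p" "\<And>j. norm (y j) \<le> norm (x j)"
  shows "y \<in> lp_space p"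
  unfolding lp_space_def mem_Collect_eq
  by (rule summable_comparison_test'[OF lp_spaceD[OF assms(1)], of 0])
     (simp add: powr_mono2 assms(2,3))

lemma lp_space_add [simp]:
  assumes "0 \<le> p" "x \<in> lp_space p" "y \<in> lp_space p"
  shows "x + y \<in> lp_space p"
proof -
  have b: "norm (x j + y j) powr p \<le> 2 powr p * (norm (x j) powr p + norm (y j) powr p)" for j
  proof -
    let ?m = "max (norm (x j)) (norm (y j))"
    have "norm (x j + y j) \<le> 2 * ?m"
      by (rule norm_triangle_le) linarith
    then have "norm (x j + y j) powr p \<le> (2 * ?m) powr p"
      by (intro powr_mono2 assms(1)) auto
    also have "\<dots> = 2 powr p * ?m powr p"
      by (rule powr_mult)
    also have "?m powr p \<le> norm (x j) powr p + norm (y j) powr p"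
      by (cases "norm (x j) \<le> norm (y j)") (auto simp: max_absorb1 max_absorb2)
    finally show ?thesis by simp
  qed
  have s: "summable (\<lambda>j. 2 powr p * (norm (x j) powr p + norm (y j) powr p))"
    by (intro summable_mult summable_add lp_spaceD assms)
  show ?thesis
    unfolding lp_space_def mem_Collect_eq plus_fun_apply
    by (rule summable_comparison_test'[OF s, of 0])
       (simp only: real_norm_def abs_of_nonneg[OF powr_ge_zero] b)
qed

lemma lp_space_sum [simp]:
  assumes "0 \<le> p" "\<And>i. i \<in> I \<Longrightarrow> u i \<in> lp_space p"
  shows "(\<Sum>i\<in>I. u i) \<in> lp_space p"
  using assms(2)
proof (induction I rule: infinite_finite_induct)
  case (insert i I)
  then have "u i + (\<Sum>i\<in>I. u i) \<in> lp_space p"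
    by (intro lp_space_add[OF assms(1)]) blast+
  then show ?case using insert.hyps by (simp only: sum.insert not_False_eq_True)
qed simp_all

lemma lp_space_diff [simp]:
  assumes "0 \<le> p" "x \<in> lp_space p" "y \<in> lp_space p"
  shows "x - y \<in> lp_space p"
proof -
  have "x + cseq_scale (-1) y \<in> lp_space p"
    by (intro lp_space_add lp_space_scale assms)
  also have "x + cseq_scale (-1) y = x - y"
    by (rule ext) simp
  finally show ?thesis .
qed

lemma subspace_lp_space: "0 \<le> p \<Longrightarrow> cseq.subspace (lp_space p)"
  by (auto simp: cseq.subspace_def)

lemma lp_space_finite_support:
  assumes "finite (seq_supp x)"
  shows "x \<in> lp_space p"
  unfolding lp_space_def mem_Collect_eq
  by (rule summable_finite[OF assms]) (auto simp: seq_supp_def)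

lemma lp_modular_nonneg: "x \<in> lp_space p \<Longrightarrow> 0 \<le> lp_modular p x"
  unfolding lp_modular_def by (intro suminf_nonneg lp_spaceD) auto

lemma lp_modular_scale:
  "x \<in> lp_space p \<Longrightarrow> lp_modular p (cseq_scale c x) = norm c powr p * lp_modular p x"
  unfolding lp_modular_def
  by (subst suminf_mult[symmetric]) (auto simp: norm_mult powr_mult lp_space_def)

lemma coord_le_lp_modular: "x \<in> lp_space p \<Longrightarrow> norm (x j) powr p \<le> lp_modular p x"
  unfolding lp_modular_def lp_space_def mem_Collect_eq
  by (drule sum_le_suminf[where I = "{j}"]) auto

lemma lp_norm_eq_modular: "lp_norm p x = lp_modular p x powr (1 / p)"
  by (simp add: lp_norm_def lp_modular_def)

lemma lp_norm_nonneg [simp]: "0 \<le> lp_norm p x"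
  by (simp add: lp_norm_def)

lemma lp_modular_eq_norm: "0 < p \<Longrightarrow> x \<in> lp_space p \<Longrightarrow> lp_modular p x = lp_norm p x powr p"
  by (simp add: lp_norm_eq_modular powr_powr lp_modular_nonneg)

lemma lp_norm_scale:
  "0 < p \<Longrightarrow> x \<in> lp_space p \<Longrightarrow> lp_norm p (cseq_scale c x) = norm c * lp_norm p x"
  by (simp add: lp_norm_eq_modular lp_modular_scale powr_mult lp_modular_nonneg powr_powr)

lemma coord_le_lp_norm:
  assumes "0 < p" "x \<in> lp_space p" shows "norm (x j) \<le> lp_norm p x"
  using powr_mono2[OF _ _ coord_le_lp_modular[OF assms(2)], of "1/p"] assms(1)
  by (simp add: lp_norm_eq_modular powr_powr)

lemma lp_norm_eq_0_iff:
  assumes "0 < p" "x \<in> lp_space p" shows "lp_norm p x = 0 \<longleftrightarrow> x = 0"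
proof
  assume "lp_norm p x = 0"
  then show "x = 0" using coord_le_lp_norm[OF assms] by (auto simp: fun_eq_iff)
qed (simp add: lp_norm_def)

lemma lp_norm_zero [simp]: "lp_norm p 0 = 0"
  by (simp add: lp_norm_def)

lemma lp_unit_sphereD:
  assumes "x \<in> lp_unit_sphere p"
  shows "x \<in> lp_space p" "lp_norm p x = 1"
  using assms by (auto simp: lp_unit_sphere_def)

lemma lp_unit_sphere_iff_modular:
  assumes "0 < p"
  shows "x \<in> lp_unit_sphere p \<longleftrightarrow> x \<in> lp_space p \<and> lp_modular p x = 1"
proof -
  have "t powr (1 / p) = 1 \<longleftrightarrow> t = 1" if "0 \<le> t" for t :: real
    using assms that by (cases "t = 0") (auto simp: powr_def)
  then show ?thesis
    using lp_modular_nonneg by (auto simp: lp_unit_sphere_def lp_norm_eq_modular)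
qed

lemma normalize_in_lp_unit_sphere:
  assumes "0 < p" "x \<in> lp_space p" "x \<noteq> 0"
  shows "cseq_scale (complex_of_real (1 / lp_norm p x)) x \<in> lp_unit_sphere p"
  using assms lp_norm_eq_0_iff[OF assms(1,2)]
  by (auto simp: lp_unit_sphere_def lp_norm_scale norm_inverse norm_divide)

lemma lp_norm_tail_tendsto_0:
  assumes "0 < p" "x \<in> lp_space p"
  shows "(\<lambda>n. lp_norm p (\<lambda>j. if n \<le> j then x j else 0)) \<longlonglongrightarrow> 0"
proof -
  let ?f = "\<lambda>j. norm (x j) powr p"
  have s: "summable ?f" by (rule lp_spaceD[OF assms(2)])
  have "lp_modular p (\<lambda>j. if n \<le> j then x j else 0) = suminf (\<lambda>j. ?f (j + n))" for n
  proof -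
    let ?g = "\<lambda>j. norm (if n \<le> j then x j else 0) powr p"
    have "summable ?g"
      by (rule summable_comparison_test'[OF s, of 0]) auto
    from suminf_split_initial_segment[OF this, of n]
    show ?thesis by (simp add: lp_modular_def)
  qed
  moreover have "(\<lambda>n. suminf (\<lambda>j. ?f (j + n))) \<longlonglongrightarrow> 0"
    by (rule LIMSEQ_I) (use suminf_exist_split[OF _ s] in \<open>fastforce\<close>)
  ultimately have "(\<lambda>n. lp_modular p (\<lambda>j. if n \<le> j then x j else 0)) \<longlonglongrightarrow> 0"
    by simp
  then have "(\<lambda>n. lp_modular p (\<lambda>j. if n \<le> j then x j else 0) powr (1 / p)) \<longlonglongrightarrow> 0 powr (1 / p)"
    using assms lp_space_dominated[OF assms(2)]
    by (intro tendsto_powr') (auto intro!: eventuallyI lp_modular_nonneg)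
  then show ?thesis by (simp add: lp_norm_eq_modular)
qed

lemma powr_convex_combination:
  assumes "1 \<le> p" "0 \<le> u" "0 \<le> v" "0 \<le> s" "s \<le> (1::real)"
  shows "(s * u + (1 - s) * v) powr p \<le> s * u powr p + (1 - s) * v powr p"
proof (cases "u = 0 \<or> v = 0 \<or> s = 0 \<or> s = 1")
  case True
  have "t powr p \<le> t" if "0 \<le> t" "t \<le> 1" for t :: real
    using powr_mono'[OF \<open>1 \<le> p\<close> that] that by simp
  from this[of s] this[of "1 - s"] True assms show ?thesis
    by (auto simp: powr_mult intro!: mult_right_mono)
next
  case False
  then show ?thesis
    using convex_onD[OF powr_convex[OF \<open>1 \<le> p\<close>], of "1 - s" u v] assms by simp
qed

text \<open>
Minkowski's inequality. With \<open>s = \<parallel>x\<parallel> / (\<parallel>x\<parallel> + \<parallel>y\<parallel>)\<close>, the vector \<open>(x + y) / (\<parallel>x\<parallel> + \<parallel>y\<parallel>)\<close> is the convex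
combination with weights \<open>s\<close> and \<open>1 - s\<close> of the normalisations of \<open>x\<close> and \<open>y\<close>; convexity of
\<open>t \<mapsto> t\<^sup>p\<close> in each coordinate bounds its modular by \<open>1\<close>.
\<close>

lemma lp_norm_triangle:
  assumes "1 < p" "x \<in> lp_space p" "y \<in> lp_space p"
  shows "lp_norm p (x + y) \<le> lp_norm p x + lp_norm p y"
proof (cases "x = 0 \<or> y = 0")
  case False
  have p0: "0 < p" using assms(1) by simp
  let ?a = "lp_norm p x" and ?b = "lp_norm p y"
  have ab: "?a > 0" "?b > 0"
    using False lp_norm_eq_0_iff[OF p0] assms lp_norm_nonneg[of p x] lp_norm_nonneg[of p y]
    by (auto simp: less_le simp del: lp_norm_nonneg)
  define s where "s = ?a / (?a + ?b)"
  have s: "0 \<le> s" "s \<le> 1" "s * (?a + ?b) = ?a" "(1 - s) * (?a + ?b) = ?b"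
    using ab by (auto simp: s_def field_simps)
  let ?h = "\<lambda>j. (?a + ?b) powr p * (s * (norm (x j) powr p / ?a powr p) + (1 - s) * (norm (y j) powr p / ?b powr p))"
  have "norm ((x + y) j) powr p \<le> ?h j" for j
  proof -
    have "norm ((x + y) j) \<le> norm (x j) + norm (y j)" by (simp add: norm_triangle_ineq)
    also have "\<dots> = ?a * (norm (x j) / ?a) + ?b * (norm (y j) / ?b)" using ab by simp
    also have "\<dots> = (?a + ?b) * (s * (norm (x j) / ?a) + (1 - s) * (norm (y j) / ?b))"
      using s(3,4) by (smt (verit) mult.assoc mult.commute distrib_left)
    finally have "norm ((x + y) j) powr p \<le> ((?a + ?b) * (s * (norm (x j) / ?a) + (1 - s) * (norm (y j) / ?b))) powr p"
      by (intro powr_mono2) (use p0 in auto)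
    also have "\<dots> = (?a + ?b) powr p * (s * (norm (x j) / ?a) + (1 - s) * (norm (y j) / ?b)) powr p"
      using ab s by (intro powr_mult)
    also have "\<dots> \<le> (?a + ?b) powr p * (s * (norm (x j) / ?a) powr p + (1 - s) * (norm (y j) / ?b) powr p)"
      using assms(1) s ab by (intro mult_left_mono powr_convex_combination) auto
    finally show ?thesis using ab by (simp add: powr_divide)
  qed
  moreover have h: "?h sums ((?a + ?b) powr p * (s * (lp_modular p x / ?a powr p) + (1 - s) * (lp_modular p y / ?b powr p)))"
    unfolding lp_modular_def
    by (intro sums_mult sums_add sums_divide summable_sums lp_spaceD assms)
  ultimately have "lp_modular p (x + y) \<le> (?a + ?b) powr p * (s * (lp_modular p x / ?a powr p) + (1 - s) * (lp_modular p y / ?b powr p))"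
    unfolding lp_modular_def[of p "x + y"] sums_unique[OF h]
    using lp_spaceD[OF lp_space_add[OF _ assms(2,3)]] p0 by (intro suminf_le sums_summable[OF h]) auto
  also have "\<dots> = (?a + ?b) powr p"
    using ab p0 assms(2,3) by (simp add: lp_modular_eq_norm)
  finally have "lp_modular p (x + y) powr (1/p) \<le> ((?a + ?b) powr p) powr (1/p)"
    using p0 assms(2,3) by (intro powr_mono2) (auto intro!: lp_modular_nonneg lp_space_add)
  then show ?thesis using p0 ab by (simp add: lp_norm_eq_modular[of p "x+y"] powr_powr)
qed auto

text \<open>
This gives access to the metric topology in which finite-codimensional subspaces are closed.
\<close>

lemma Metric_space_lp:
  assumes "1 < p" shows "Metric_space (lp_space p) (lp_dist p)"
proof
  have p0: "0 < p" using assms by simp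
  show "0 \<le> lp_dist p x y" for x y by (simp add: lp_dist_def)
  show "lp_dist p x y = lp_dist p y x" for x y
    by (simp add: lp_dist_def lp_norm_def norm_minus_commute)
  fix x y assume xy: "x \<in> lp_space p" "y \<in> lp_space p"
  show "lp_dist p x y = 0 \<longleftrightarrow> x = y"
    using xy p0 lp_norm_eq_0_iff[of p "x - y"] by (simp add: lp_dist_def)
  fix z assume z: "z \<in> lp_space p"
  show "lp_dist p x z \<le> lp_dist p x y + lp_dist p y z"
    using lp_norm_triangle[OF assms, of "x - y" "y - z"] xy z p0 by (simp add: lp_dist_def)
qed

section \<open>The duality map and its bracket\<close>

lemma norm_duality_map: "1 < p \<Longrightarrow> norm (duality_map p y j) = norm (y j) powr (p - 1)"
proof (cases "y j = 0")
  case False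
  assume "1 < p"
  have "norm (y j) * norm (y j) powr (p - 2) = norm (y j) powr (1 + (p - 2))"
    using powr_mult_base[of "norm (y j)" "p - 2"] by simp
  then show ?thesis by (simp add: duality_map_def norm_mult)
qed (simp add: duality_map_def)

text \<open>
Young's inequality for the conjugate exponent \<open>q = p / (p - 1)\<close>, in terms of \<open>p\<close> alone.
\<close>

lemma Young_duality:
  assumes "1 < p" "0 \<le> s" "0 \<le> (t::real)"
  shows "s * t powr (p - 1) \<le> s powr p / p + (1 - 1 / p) * t powr p"
proof -
  define q where "q = p / (p - 1)"
  have q: "q > 1" "1 / p + 1 / q = 1" "(p - 1) * q = p" "1 / q = 1 - 1 / p"
    using assms(1) by (auto simp: q_def field_simps)
  have "s * t powr (p - 1) \<le> s powr p / p + (t powr (p - 1)) powr q / q"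
    by (rule Youngs_inequality) (use assms q in auto)
  also have "(t powr (p - 1)) powr q / q = (1 - 1 / p) * t powr p"
    using q(3,4) by (simp add: powr_powr divide_inverse)
  finally show ?thesis .
qed

text \<open>
Hoelder's inequality with \<open>J(y)\<close> in the place of the vector of \<open>\<ell>\<^sub>q\<close>, whose norm there is \<open>\<parallel>y\<parallel>\<^sup>p\<^sup>-\<^sup>1\<close>. The
estimate follows by summing Young's inequality for the normalised vectors.
\<close>

lemma Holder_bracket:
  assumes p: "1 < p" and x: "x \<in> lp_space p" and y: "y \<in> lp_space p"
  shows summable_bracket: "summable (\<lambda>j. norm (x j * cnj (duality_map p y j)))"
    and norm_bracket_le: "norm (bracket p x y) \<le> lp_norm p x * lp_norm p y powr (p - 1)"
proof -
  have p0: "0 < p" using p by simp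
  have term_eq: "norm (x j * cnj (duality_map p y j)) = norm (x j) * norm (y j) powr (p - 1)" for j
    using norm_duality_map[OF p, of y j] by (simp add: norm_mult)
  have s: "summable (\<lambda>j. norm (x j) powr p / p + (1 - 1 / p) * norm (y j) powr p)"
    by (intro summable_add summable_divide summable_mult lp_spaceD x y)
  have Young: "norm (x j) * norm (y j) powr (p - 1) \<le> norm (x j) powr p / p + (1 - 1 / p) * norm (y j) powr p" for j
    by (rule Young_duality[OF p]) auto
  show sm: "summable (\<lambda>j. norm (x j * cnj (duality_map p y j)))"
    by (rule summable_comparison_test'[OF s, of 0]) (simp add: term_eq Young)
  show "norm (bracket p x y) \<le> lp_norm p x * lp_norm p y powr (p - 1)"
  proof (cases "x = 0 \<or> y = 0")
    case True
    then show ?thesis by (auto simp: pairing_def duality_map_def)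
  next
    case False
    define a b where "a = lp_norm p x" and "b = lp_norm p y"
    have ab: "a > 0" "b > 0"
      using False lp_norm_eq_0_iff[OF p0 x] lp_norm_eq_0_iff[OF p0 y]
        lp_norm_nonneg[of p x] lp_norm_nonneg[of p y] unfolding a_def b_def by linarith+
    let ?c = "a * b powr (p - 1)"
    let ?h = "\<lambda>j. ?c * (norm (x j) powr p / a powr p / p + (1 - 1 / p) * (norm (y j) powr p / b powr p))"
    have le: "norm (x j * cnj (duality_map p y j)) \<le> ?h j" for j
    proof -
      have "norm (x j * cnj (duality_map p y j)) = ?c * ((norm (x j) / a) * (norm (y j) / b) powr (p - 1))"
        using ab by (simp only: term_eq) (simp add: powr_divide)
      also have "\<dots> \<le> ?c * ((norm (x j) / a) powr p / p + (1 - 1 / p) * (norm (y j) / b) powr p)"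
        using ab by (intro mult_left_mono Young_duality p) auto
      finally show ?thesis using ab by (simp add: powr_divide)
    qed
    have h: "?h sums (?c * (lp_modular p x / a powr p / p + (1 - 1 / p) * (lp_modular p y / b powr p)))"
      unfolding lp_modular_def
      by (intro sums_mult sums_add sums_divide summable_sums lp_spaceD x y)
    have "norm (bracket p x y) \<le> (\<Sum>j. norm (x j * cnj (duality_map p y j)))"
      unfolding pairing_def by (rule summable_norm[OF sm])
    also have "\<dots> \<le> ?c * (lp_modular p x / a powr p / p + (1 - 1 / p) * (lp_modular p y / b powr p))"
      unfolding sums_unique[OF h] by (intro suminf_le le sm sums_summable[OF h])
    also have "\<dots> = ?c"
      using ab p0 x y by (simp add: lp_modular_eq_norm a_def b_def)
    finally show ?thesis by (simp add: a_def b_def)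
  qed
qed

lemma bracket_sums:
  assumes "1 < p" "x \<in> lp_space p" "y \<in> lp_space p"
  shows "(\<lambda>j. x j * cnj (duality_map p y j)) sums bracket p x y"
  unfolding pairing_def
  by (rule summable_sums[OF summable_norm_cancel[OF summable_bracket[OF assms]]])

lemma bracket_add_left:
  assumes "1 < p" "x \<in> lp_space p" "x' \<in> lp_space p" "y \<in> lp_space p"
  shows "bracket p (x + x') y = bracket p x y + bracket p x' y"
proof -
  have "(\<lambda>j. (x + x') j * cnj (duality_map p y j)) sums (bracket p x y + bracket p x' y)"
    using sums_add[OF bracket_sums[OF assms(1,2,4)] bracket_sums[OF assms(1,3,4)]]
    by (simp add: distrib_right)
  then show ?thesis unfolding pairing_def by (rule sums_unique[symmetric])
qed

lemma bracket_scale_left: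
  assumes "1 < p" "x \<in> lp_space p" "y \<in> lp_space p"
  shows "bracket p (cseq_scale c x) y = c * bracket p x y"
proof -
  have "(\<lambda>j. cseq_scale c x j * cnj (duality_map p y j)) sums (c * bracket p x y)"
    using sums_mult[OF bracket_sums[OF assms], of c] by (simp add: mult.assoc)
  then show ?thesis unfolding pairing_def by (rule sums_unique[symmetric])
qed

lemma duality_map_scale:
  "duality_map p (cseq_scale c y) j = c * of_real (norm c powr (p - 2)) * duality_map p y j"
  by (simp add: duality_map_def norm_mult powr_mult)

lemma bracket_scale_right:
  assumes "1 < p" "x \<in> lp_space p" "y \<in> lp_space p"
  shows "bracket p x (cseq_scale c y) = cnj c * of_real (norm c powr (p - 2)) * bracket p x y"
proof -
  let ?d = "cnj c * of_real (norm c powr (p - 2))"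
  have "(\<lambda>j. x j * cnj (duality_map p (cseq_scale c y) j)) sums (?d * bracket p x y)"
    using sums_mult[OF bracket_sums[OF assms], of ?d]
    by (simp add: duality_map_scale ac_simps)
  then show ?thesis unfolding pairing_def by (rule sums_unique[symmetric])
qed

text \<open>
The scalar \<open>cnj c * \<bar>c\<bar>\<^sup>p\<^sup>-\<^sup>2\<close> is what the second argument of the bracket contributes when it is
multiplied by \<open>c\<close>; together with \<open>c\<close> from the first argument it gives \<open>\<bar>c\<bar>\<^sup>p\<close>.
\<close>

lemma mult_cnj_norm_powr:
  assumes "1 < p"
  shows "c * (cnj c * of_real (norm c powr (p - 2))) = of_real (norm c powr p)"
proof (cases "c = 0")
  case False
  have "(norm c)\<^sup>2 * norm c powr (p - 2) = norm c powr p"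
    using False powr_add[of "norm c" 2 "p - 2"] by simp
  then show ?thesis
    unfolding mult.assoc[symmetric] complex_norm_square[symmetric]
    by (metis of_real_mult of_real_power)
qed simp

section \<open>Sums with disjoint supports\<close>

text \<open>
In each coordinate at most one summand is nonzero, so any coordinatewise operation that sends \<open>0\<close> to
\<open>0\<close> commutes with the sum, however nonlinear it is. It is used below for \<open>\<bar>z\<bar>\<^sup>p\<close> and for
\<open>z \<bar>z\<bar>\<^sup>p\<^sup>-\<^sup>2\<close>.
\<close>

lemma disjoint_sum_apply:
  fixes u :: "'i \<Rightarrow> nat \<Rightarrow> complex" and h :: "complex \<Rightarrow> 'b::comm_monoid_add"
  assumes "finite I" "disjoint_family_on (\<lambda>i. seq_supp (u i)) I" "h 0 = 0"
  shows "h ((\<Sum>i\<in>I. u i) j) = (\<Sum>i\<in>I. h (u i j))"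
proof (cases "\<exists>k\<in>I. u k j \<noteq> 0")
  case True
  then obtain k where k: "k \<in> I" "u k j \<noteq> 0" by blast
  have z: "u i j = 0" if "i \<in> I - {k}" for i
    using disjoint_family_onD[OF assms(2), of i k] that k by (auto simp: seq_supp_def)
  have "(\<Sum>i\<in>I. u i j) = u k j" "(\<Sum>i\<in>I. h (u i j)) = h (u k j)"
    using z assms(3) by (auto simp: sum.remove[OF assms(1) k(1)])
  then show ?thesis by (simp add: sum_seq_apply)
next
  case False
  then show ?thesis by (simp add: sum_seq_apply assms(3))
qed

lemma lp_modular_disjoint_sum:
  assumes "finite I" "disjoint_family_on (\<lambda>i. seq_supp (u i)) I" "\<And>i. i \<in> I \<Longrightarrow> u i \<in> lp_space p"
  shows "lp_modular p (\<Sum>i\<in>I. u i) = (\<Sum>i\<in>I. lp_modular p (u i))"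
  unfolding lp_modular_def
  by (simp add: disjoint_sum_apply[OF assms(1,2), of "\<lambda>z. norm z powr p"] suminf_sum lp_spaceD assms(3))

lemma duality_map_disjoint_sum:
  assumes "finite I" "disjoint_family_on (\<lambda>i. seq_supp (u i)) I"
  shows "duality_map p (\<Sum>i\<in>I. u i) j = (\<Sum>i\<in>I. duality_map p (u i) j)"
  unfolding duality_map_def
  by (rule disjoint_sum_apply[OF assms, of "\<lambda>z. z * complex_of_real (norm z powr (p - 2))"]) simp

lemma bracket_disjoint_sum_right:
  assumes "1 < p" "finite I" "disjoint_family_on (\<lambda>i. seq_supp (u i)) I"
    "\<And>i. i \<in> I \<Longrightarrow> u i \<in> lp_space p" "x \<in> lp_space p"
  shows "bracket p x (\<Sum>i\<in>I. u i) = (\<Sum>i\<in>I. bracket p x (u i))"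
proof -
  have "(\<lambda>j. \<Sum>i\<in>I. x j * cnj (duality_map p (u i) j)) sums (\<Sum>i\<in>I. bracket p x (u i))"
    by (intro sums_sum bracket_sums assms)
  then have "(\<lambda>j. x j * cnj (duality_map p (\<Sum>i\<in>I. u i) j)) sums (\<Sum>i\<in>I. bracket p x (u i))"
    by (simp add: duality_map_disjoint_sum[OF assms(2,3)] sum_distrib_left)
  then show ?thesis unfolding pairing_def[of x "duality_map p (\<Sum>i\<in>I. u i)"] by (rule sums_unique[symmetric])
qed

text \<open>
Two vectors are treated as a family indexed by the Booleans, so that the results for families apply.
\<close>

lemma disjoint_add_as_sum:
  fixes v r :: "nat \<Rightarrow> complex"
  assumes "seq_supp v \<inter> seq_supp r = {}"
  obtains u where "v + r = (\<Sum>b\<in>UNIV. u b)" "u True = v" "u False = r"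
    "disjoint_family_on (\<lambda>b::bool. seq_supp (u b)) UNIV"
proof
  let ?u = "\<lambda>b. if b then v else r"
  show "v + r = (\<Sum>b\<in>UNIV. ?u b)" by (simp add: UNIV_bool add.commute)
  show "disjoint_family_on (\<lambda>b. seq_supp (?u b)) UNIV"
    using assms by (auto simp: disjoint_family_on_def)
qed auto

lemma lp_modular_disjoint_add:
  assumes "seq_supp v \<inter> seq_supp r = {}" "v \<in> lp_space p" "r \<in> lp_space p"
  shows "lp_modular p (v + r) = lp_modular p v + lp_modular p r"
proof -
  obtain u where u: "v + r = (\<Sum>b\<in>UNIV. u b)" "u True = v" "u False = r"
    "disjoint_family_on (\<lambda>b::bool. seq_supp (u b)) UNIV"
    using disjoint_add_as_sum[OF assms(1)] by metis
  have "u b \<in> lp_space p" for b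
    using u(2,3) assms(2,3) by (cases b) auto
  from lp_modular_disjoint_sum[OF _ u(4) this] show ?thesis
    unfolding u(1) by (simp add: UNIV_bool u(2,3))
qed

lemma bracket_disjoint_add_right:
  assumes "1 < p" "seq_supp v \<inter> seq_supp r = {}" "v \<in> lp_space p" "r \<in> lp_space p" "x \<in> lp_space p"
  shows "bracket p x (v + r) = bracket p x v + bracket p x r"
proof -
  obtain u where u: "v + r = (\<Sum>b\<in>UNIV. u b)" "u True = v" "u False = r"
    "disjoint_family_on (\<lambda>b::bool. seq_supp (u b)) UNIV"
    using disjoint_add_as_sum[OF assms(2)] by metis
  have "u b \<in> lp_space p" for b
    using u(2,3) assms(3,4) by (cases b) auto
  from bracket_disjoint_sum_right[OF assms(1) _ u(4) this assms(5)] show ?thesis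
    unfolding u(1) by (simp add: UNIV_bool u(2,3))
qed

section \<open>Functionals and operators\<close>

lemma lp_dual_add: "\<phi> \<in> lp_dual p \<Longrightarrow> x \<in> lp_space p \<Longrightarrow> y \<in> lp_space p \<Longrightarrow> \<phi> (x + y) = \<phi> x + \<phi> y"
  by (simp add: lp_dual_def)

lemma lp_dual_scale: "\<phi> \<in> lp_dual p \<Longrightarrow> x \<in> lp_space p \<Longrightarrow> \<phi> (cseq_scale c x) = c * \<phi> x"
  by (simp add: lp_dual_def)

lemma lp_dual_bound:
  assumes "\<phi> \<in> lp_dual p"
  obtains K where "0 \<le> K" "\<And>x. x \<in> lp_space p \<Longrightarrow> norm (\<phi> x) \<le> K * lp_norm p x"
proof -
  obtain K where K: "\<forall>x\<in>lp_space p. norm (\<phi> x) \<le> K * lp_norm p x"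
    using assms unfolding lp_dual_def by blast
  have "K * lp_norm p x \<le> \<bar>K\<bar> * lp_norm p x" for x
    by (intro mult_right_mono) auto
  then have "norm (\<phi> x) \<le> \<bar>K\<bar> * lp_norm p x" if "x \<in> lp_space p" for x
    using bspec[OF K that] order_trans by blast
  then show thesis using that[of "\<bar>K\<bar>"] by simp
qed

lemma lp_dual_sum:
  assumes "\<phi> \<in> lp_dual p" "0 \<le> p" "\<And>i. i \<in> I \<Longrightarrow> u i \<in> lp_space p"
  shows "\<phi> (\<Sum>i\<in>I. cseq_scale (a i) (u i)) = (\<Sum>i\<in>I. a i * \<phi> (u i))"
proof -
  have z: "\<phi> 0 = 0"
    using lp_dual_scale[OF assms(1) lp_space_zero, of 0] by (simp only: cseq.scale_zero_left mult_zero_left)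
  show ?thesis
    using assms(3)
  proof (induction I rule: infinite_finite_induct)
    case (insert i I)
    have "\<phi> (cseq_scale (a i) (u i) + (\<Sum>i\<in>I. cseq_scale (a i) (u i)))
        = a i * \<phi> (u i) + \<phi> (\<Sum>i\<in>I. cseq_scale (a i) (u i))"
      using insert.prems
      by (simp only: lp_dual_add[OF assms(1)] lp_dual_scale[OF assms(1)] lp_space_sum[OF assms(2)]
          lp_space_scale insert_iff simp_thms)
    also have "\<phi> (\<Sum>i\<in>I. cseq_scale (a i) (u i)) = (\<Sum>i\<in>I. a i * \<phi> (u i))"
      using insert.prems by (intro insert.IH) auto
    finally show ?case using insert.hyps by (simp only: sum.insert not_False_eq_True)
  qed (simp_all only: sum.infinite sum.empty z not_False_eq_True)
qed

lemma coordinate_in_lp_dual: "0 < p \<Longrightarrow> (\<lambda>x. x j) \<in> lp_dual p"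
  by (auto simp: lp_dual_def intro!: exI[of _ 1] coord_le_lp_norm)

lemma lp_operator_space: "lp_operator p T \<Longrightarrow> x \<in> lp_space p \<Longrightarrow> T x \<in> lp_space p"
  by (simp add: lp_operator_def)

lemma lp_operator_bracket_bound:
  assumes "1 < p" "lp_operator p T"
  shows "\<exists>K\<ge>0. \<forall>x\<in>lp_space p. \<forall>y\<in>lp_space p.
    norm (bracket p (T x) y) \<le> K * lp_norm p x * lp_norm p y powr (p - 1)"
proof -
  obtain K where K: "\<forall>x\<in>lp_space p. lp_norm p (T x) \<le> K * lp_norm p x"
    using assms(2) unfolding lp_operator_def by blast
  have "norm (bracket p (T x) y) \<le> \<bar>K\<bar> * lp_norm p x * lp_norm p y powr (p - 1)"
    if "x \<in> lp_space p" "y \<in> lp_space p" for x y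
  proof -
    have "norm (bracket p (T x) y) \<le> lp_norm p (T x) * lp_norm p y powr (p - 1)"
      by (rule norm_bracket_le[OF assms(1) lp_operator_space[OF assms(2) that(1)] that(2)])
    also have "lp_norm p (T x) \<le> \<bar>K\<bar> * lp_norm p x"
      using bspec[OF K that(1)] mult_right_mono[OF abs_ge_self[of K] lp_norm_nonneg[of p x]] by linarith
    finally show ?thesis by (simp add: mult_right_mono)
  qed
  then show ?thesis by (intro exI[of _ "\<bar>K\<bar>"]) simp
qed

lemma bracket_operator_in_lp_dual:
  assumes "1 < p" "lp_operator p T" "y \<in> lp_space p"
  shows "(\<lambda>x. bracket p (T x) y) \<in> lp_dual p"
proof -
  obtain K where K: "\<forall>x\<in>lp_space p. \<forall>y\<in>lp_space p.
      norm (bracket p (T x) y) \<le> K * lp_norm p x * lp_norm p y powr (p - 1)"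
    using lp_operator_bracket_bound[OF assms(1,2)] by blast
  have "norm (bracket p (T x) y) \<le> (K * lp_norm p y powr (p - 1)) * lp_norm p x" if "x \<in> lp_space p" for x
    using bspec[OF bspec[OF K that] assms(3)] by (simp add: ac_simps)
  then show ?thesis
    using assms by (auto simp: lp_dual_def lp_operator_def bracket_add_left bracket_scale_left)
qed

lemma bracket_operator_scale:
  assumes "1 < p" "lp_operator p T" "x \<in> lp_space p"
  shows "bracket p (T (cseq_scale c x)) (cseq_scale c x) = of_real (norm c powr p) * bracket p (T x) x"
proof -
  have "bracket p (T (cseq_scale c x)) (cseq_scale c x) = c * bracket p (T x) (cseq_scale c x)"
    by (rule lp_dual_scale[OF bracket_operator_in_lp_dual[OF assms(1,2) lp_space_scale[OF assms(3)]] assms(3)])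
  also have "\<dots> = (c * (cnj c * of_real (norm c powr (p - 2)))) * bracket p (T x) x"
    using assms by (simp add: bracket_scale_right lp_operator_space)
  finally show ?thesis by (simp only: mult_cnj_norm_powr[OF assms(1)])
qed

section \<open>Blocks far out\<close>

text \<open>
Gliding hump: if \<open>P\<close> has finitely supported instances arbitrarily far out, and each instance is
related by \<open>R\<close> to all instances beyond some index, then blocks can be chosen one after the other, each
beyond the supports and the indices of all its predecessors. The recursion carries, along with each
block, an index that bounds its support and works for its relation; these indices never decrease.
\<close>

lemma block_sequence:
  fixes P :: "(nat \<Rightarrow> complex) \<Rightarrow> bool" and R :: "(nat \<Rightarrow> complex) \<Rightarrow> (nat \<Rightarrow> complex) \<Rightarrow> bool"
  assumes ex: "\<And>n. \<exists>x. P x \<and> finite (seq_supp x) \<and> seq_supp x \<subseteq> {n..}"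
    and tail: "\<And>x. P x \<Longrightarrow> \<exists>m. \<forall>y. P y \<longrightarrow> finite (seq_supp y) \<longrightarrow> seq_supp y \<subseteq> {m..} \<longrightarrow> R x y"
  shows "\<exists>u::nat \<Rightarrow> nat \<Rightarrow> complex. (\<forall>i. P (u i)) \<and> (\<forall>i. finite (seq_supp (u i))) \<and>
    disjoint_family (\<lambda>i. seq_supp (u i)) \<and> (\<forall>i j. i < j \<longrightarrow> R (u i) (u j))"
proof -
  define good where "good z \<longleftrightarrow> P (fst z) \<and> finite (seq_supp (fst z)) \<and> seq_supp (fst z) \<subseteq> {..<snd z} \<and>
    (\<forall>y. P y \<longrightarrow> finite (seq_supp y) \<longrightarrow> seq_supp y \<subseteq> {snd z..} \<longrightarrow> R (fst z) y)" for z :: "(nat \<Rightarrow> complex) \<times> nat"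
  have step: "\<exists>z. good z \<and> seq_supp (fst z) \<subseteq> {n..} \<and> n \<le> snd z" for n
  proof -
    obtain x where x: "P x" "finite (seq_supp x)" "seq_supp x \<subseteq> {n..}" using ex by blast
    obtain m where m: "\<And>y. P y \<Longrightarrow> finite (seq_supp y) \<Longrightarrow> seq_supp y \<subseteq> {m..} \<Longrightarrow> R x y"
      using tail[OF x(1)] by blast
    obtain b where b: "seq_supp x \<subseteq> {..<b}" using finite_nat_bounded[OF x(2)] by blast
    have "good (x, max n (max m b))"
      using x b m by (fastforce simp: good_def)
    then show ?thesis using x(3) by (intro exI[of _ "(x, max n (max m b))"]) auto
  qed
  have "\<exists>z. \<forall>k::nat. good (z k) \<and> (seq_supp (fst (z (Suc k))) \<subseteq> {snd (z k)..} \<and> snd (z k) \<le> snd (z (Suc k)))"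
    by (rule dependent_nat_choice) (use step in blast)+
  then obtain z where z: "\<And>k::nat. good (z k)" "\<And>k. seq_supp (fst (z (Suc k))) \<subseteq> {snd (z k)..}"
    "\<And>k. snd (z k) \<le> snd (z (Suc k))" by blast
  have mono: "snd (z i) \<le> snd (z j)" if "i \<le> j" for i j
    using z(3) that by (rule lift_Suc_mono_le)
  have later: "seq_supp (fst (z j)) \<subseteq> {snd (z i)..}" if "i < j" for i j
    using z(2)[of "j - 1"] mono[of i "j - 1"] that by fastforce
  have disj: "seq_supp (fst (z i)) \<inter> seq_supp (fst (z j)) = {}" if "i < j" for i j
    using later[OF that] z(1)[of i] by (fastforce simp: good_def)
  have "disjoint_family (\<lambda>i. seq_supp (fst (z i)))"
    unfolding disjoint_family_on_def using disj by (metis inf_commute nat_neq_iff)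
  moreover have "R (fst (z i)) (fst (z j))" if "i < j" for i j
    using z(1)[of i] z(1)[of j] later[OF that] by (auto simp: good_def)
  ultimately show ?thesis
    using z(1) unfolding good_def by (intro exI[of _ "\<lambda>i. fst (z i)"]) blast
qed

lemma seq_supp_scale: "seq_supp (cseq_scale c x) \<subseteq> seq_supp x"
  by (auto simp: seq_supp_def)

lemma disjoint_family_on_scale:
  "disjoint_family_on (\<lambda>i. seq_supp (u i)) I \<Longrightarrow> disjoint_family_on (\<lambda>i. seq_supp (cseq_scale (a i) (u i))) I"
  using seq_supp_scale by (fastforce simp: disjoint_family_on_def)

lemma lp_modular_block_combination:
  assumes "0 < p" "finite I" "disjoint_family_on (\<lambda>i. seq_supp (u i)) I" "\<And>i. i \<in> I \<Longrightarrow> u i \<in> lp_unit_sphere p"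
  shows "lp_modular p (\<Sum>i\<in>I. cseq_scale (a i) (u i)) = (\<Sum>i\<in>I. norm (a i) powr p)"
proof -
  have u: "u i \<in> lp_space p" "lp_modular p (u i) = 1" if "i \<in> I" for i
    using assms(4)[OF that] lp_unit_sphere_iff_modular[OF assms(1)] by blast+
  have "lp_modular p (\<Sum>i\<in>I. cseq_scale (a i) (u i)) = (\<Sum>i\<in>I. lp_modular p (cseq_scale (a i) (u i)))"
    by (intro lp_modular_disjoint_sum assms(2) disjoint_family_on_scale assms(3) lp_space_scale u)
  also have "\<dots> = (\<Sum>i\<in>I. norm (a i) powr p)"
    by (intro sum.cong) (auto simp: lp_modular_scale u)
  finally show ?thesis .
qed

text \<open>
Finitely supported unit vectors that move to infinity are weakly null. Otherwise there would be
disjoint unit blocks \<open>u\<^sub>i\<close> with \<open>\<bar>\<phi>(u\<^sub>i)\<bar> \<ge> \<eta>\<close>. After rotating each block so that \<open>\<phi>(u\<^sub>i) \<ge> \<eta>\<close>, the sum of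
\<open>N\<close> blocks has norm \<open>N\<^sup>1\<^sup>/\<^sup>p\<close> but a value of at least \<open>N \<eta>\<close>, and \<open>N \<eta> \<le> K N\<^sup>1\<^sup>/\<^sup>p\<close> fails for large \<open>N\<close>
because \<open>p > 1\<close>.
\<close>

lemma functional_small_on_tails:
  assumes p: "1 < p" and \<phi>: "\<phi> \<in> lp_dual p" and \<eta>: "0 < \<eta>"
  shows "\<exists>n. \<forall>x\<in>lp_unit_sphere p. finite (seq_supp x) \<longrightarrow> seq_supp x \<subseteq> {n..} \<longrightarrow> norm (\<phi> x) < \<eta>"
proof (rule ccontr)
  assume "\<not> ?thesis"
  then have ex: "\<exists>x. (x \<in> lp_unit_sphere p \<and> \<eta> \<le> norm (\<phi> x)) \<and> finite (seq_supp x) \<and> seq_supp x \<subseteq> {n..}" for n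
    by (meson not_less)
  from block_sequence[OF ex, of "\<lambda>_ _. True"]
  obtain u :: "nat \<Rightarrow> nat \<Rightarrow> complex" where u: "\<And>i. u i \<in> lp_unit_sphere p \<and> \<eta> \<le> norm (\<phi> (u i))"
    "disjoint_family (\<lambda>i. seq_supp (u i))" by blast
  have ul: "u i \<in> lp_space p" for i using u(1) lp_unit_sphereD by blast
  obtain K where K: "0 \<le> K" "\<And>x. x \<in> lp_space p \<Longrightarrow> norm (\<phi> x) \<le> K * lp_norm p x"
    using lp_dual_bound[OF \<phi>] by blast
  have bound: "real N * \<eta> \<le> K * real N powr (1 / p)" for N
  proof -
    \<comment> \<open>The unimodular factors turn each \<open>\<phi> (u i)\<close> into its modulus.\<close>
    let ?y = "\<Sum>i<N. cseq_scale (cnj (sgn (\<phi> (u i)))) (u i)"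
    have sgn: "cnj (sgn z) * z = of_real (norm z)" for z :: complex
    proof (cases "z = 0")
      case False
      have "cnj (sgn z) * z = (z * cnj z) / of_real (norm z)"
        by (simp add: sgn_eq)
      also have "\<dots> = of_real ((norm z)\<^sup>2 / norm z)"
        by (simp only: complex_norm_square[symmetric] of_real_divide)
      finally show ?thesis using False by (simp add: power2_eq_square)
    qed simp
    have "norm (sgn (\<phi> (u i))) = 1" for i
      using u(1)[of i] \<eta> by (auto simp: norm_sgn)
    then have "lp_modular p ?y = N"
      using p u disjoint_family_on_mono[OF subset_UNIV u(2)]
      by (subst lp_modular_block_combination) auto
    then have "lp_norm p ?y = real N powr (1 / p)"
      by (simp add: lp_norm_eq_modular)
    moreover have "\<phi> ?y = of_real (\<Sum>i<N. norm (\<phi> (u i)))"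
      using p ul by (subst lp_dual_sum[OF \<phi>]) (auto simp: sgn)
    then have "norm (\<phi> ?y) = (\<Sum>i<N. norm (\<phi> (u i)))"
      by (simp only: norm_of_real) (simp add: sum_nonneg)
    moreover have "(\<Sum>i<N. \<eta>) \<le> (\<Sum>i<N. norm (\<phi> (u i)))"
      by (intro sum_mono) (use u(1) in blast)
    moreover have "?y \<in> lp_space p"
      using p ul by (intro lp_space_sum lp_space_scale) auto
    ultimately show ?thesis using K(2)[of ?y] by simp
  qed
  define s where "s = 1 - 1 / p"
  have s: "0 < s" using p by (simp add: s_def)
  obtain N :: nat where N: "(K / \<eta>) powr (1 / s) < real N"
    using reals_Archimedean2 by blast
  have N0: "0 < N" using le_less_trans[OF powr_ge_zero N] by simp
  have "K / \<eta> = ((K / \<eta>) powr (1 / s)) powr s"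
    using s K(1) \<eta> by (simp add: powr_powr)
  also have "\<dots> < real N powr s"
    using s N by (intro powr_less_mono2) auto
  finally have "K < \<eta> * real N powr s"
    using \<eta> by (simp add: field_simps)
  then have "K * real N powr (1 / p) < \<eta> * (real N powr s * real N powr (1 / p))"
    using N0 by simp
  also have "real N powr s * real N powr (1 / p) = real N"
    using N0 by (simp add: s_def flip: powr_add)
  finally show False using bound[of N] by (simp add: mult.commute)
qed

text \<open>
The bracket with a vector supported in \<open>{n..}\<close> sees only the tail of \<open>w\<close>, whose norm tends to \<open>0\<close>.
\<close>

lemma bracket_small_on_tails:
  assumes p: "1 < p" and w: "w \<in> lp_space p" and \<eta>: "0 < \<eta>"
  shows "\<exists>n. \<forall>x\<in>lp_unit_sphere p. seq_supp x \<subseteq> {n..} \<longrightarrow> norm (bracket p w x) < \<eta>"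
proof -
  let ?w = "\<lambda>n j. if n \<le> j then w j else 0"
  have "eventually (\<lambda>n. lp_norm p (?w n) < \<eta>) sequentially"
    using order_tendstoD(2)[OF lp_norm_tail_tendsto_0[OF _ w] \<eta>] p by simp
  then obtain n where n: "lp_norm p (?w n) < \<eta>"
    using eventually_happens'[OF sequentially_bot] by blast
  have "norm (bracket p w x) < \<eta>" if x: "x \<in> lp_unit_sphere p" "seq_supp x \<subseteq> {n..}" for x
  proof -
    have "duality_map p x j = 0" if "j < n" for j
      using x(2) that by (force simp: duality_map_def seq_supp_def)
    then have "w j * cnj (duality_map p x j) = ?w n j * cnj (duality_map p x j)" for j
      by (cases "n \<le> j") auto
    then have "bracket p w x = bracket p (?w n) x"
      unfolding pairing_def by presburger
    also have "norm \<dots> \<le> lp_norm p (?w n) * lp_norm p x powr (p - 1)"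
      using p lp_unit_sphereD(1)[OF x(1)] lp_space_dominated[OF w, of "?w n"]
      by (intro norm_bracket_le) auto
    finally show ?thesis using n lp_unit_sphereD(2)[OF x(1)] by simp
  qed
  then show ?thesis by blast
qed

text \<open>
A reduced echelon form, without reference to bases: the members of a finite-dimensional space of
sequences are determined, linearly, by finitely many of their coordinates. Since coordinates are
bounded by the norm, this makes estimates on finitely many vectors \<open>g m\<close> uniform over the unit
sphere, which takes the place of a compactness argument.

When a vector \<open>b\<close> is added, its defect \<open>r = b - L b\<close> from the representation of the smaller space
is either \<open>0\<close>, and nothing has to change, or has some coordinate \<open>r i \<noteq> 0\<close>. Then \<open>i\<close> is added to the
list of coordinates, with the vector \<open>h = r / r i\<close>, and the old \<open>g m\<close> are corrected so that \<open>h\<close>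
receives the coefficient \<open>f i - L f i\<close>, the part of the coordinate \<open>i\<close> not yet explained.
\<close>

lemma finite_dim_coordinate_representation:
  assumes "finite B" "B \<subseteq> lp_space p" "0 \<le> p"
  shows "\<exists>(d::nat) c g. (\<forall>m<d. g m \<in> lp_space p) \<and>
    (\<forall>f\<in>cseq.span B. f = (\<Sum>m<d. cseq_scale (f (c m)) (g m)))"
  using assms(1,2)
proof (induction B)
  case empty
  show ?case by (rule exI[of _ 0]) (simp add: cseq.span_empty del: cseq_scale_apply)
next
  case (insert b B)
  then obtain d :: nat and c g where g: "\<And>m. m < d \<Longrightarrow> g m \<in> lp_space p"
    and rep: "\<And>f. f \<in> cseq.span B \<Longrightarrow> f = (\<Sum>m<d. cseq_scale (f (c m)) (g m))"
    by blast
  define L where "L f = (\<Sum>m<d. cseq_scale (f (c m)) (g m))" for f :: "nat \<Rightarrow> complex"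
  have L_app: "L f j = (\<Sum>m<d. f (c m) * g m j)" for f j
    by (simp add: L_def sum_seq_apply)
  define r where "r = b - L b"
  have r: "r \<in> lp_space p"
    unfolding r_def L_def using insert.prems g assms(3)
    by (intro lp_space_diff lp_space_sum lp_space_scale) auto
  have decomp: "f - L f = cseq_scale k r" if "f - cseq_scale k b \<in> cseq.span B" for f k
  proof -
    have "f - cseq_scale k b = L (f - cseq_scale k b)"
      using rep[OF that] by (simp only: L_def)
    then have "f j - k * b j = L (f - cseq_scale k b) j" for j
      by (metis cseq_scale_apply minus_apply)
    also have "L (f - cseq_scale k b) j = L f j - k * L b j" for j
      by (simp add: L_app left_diff_distrib sum_subtractf sum_distrib_left mult.assoc)
    finally have "f j - L f j = k * (b j - L b j)" for j
      by (simp add: algebra_simps)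
    then show ?thesis
      by (simp add: fun_eq_iff r_def)
  qed
  show ?case
  proof (cases "r = 0")
    case True
    have "f = L f" if f: "f \<in> cseq.span (insert b B)" for f
    proof -
      obtain k where "f - cseq_scale k b \<in> cseq.span B"
        using f unfolding cseq.span_insert by blast
      from decomp[OF this] True show ?thesis by (simp only: cseq.scale_zero_right right_minus_eq)
    qed
    then show ?thesis using g unfolding L_def by blast
  next
    case False
    then obtain i where i: "r i \<noteq> 0" by (auto simp: fun_eq_iff)
    define h where "h = cseq_scale (1 / r i) r"
    define g' where "g' m = (if m < d then g m - cseq_scale (g m i) h else h)" for m
    define c' where "c' m = (if m < d then c m else i)" for m
    have h: "h \<in> lp_space p" using r by (simp add: h_def)
    have "f = (\<Sum>m<Suc d. cseq_scale (f (c' m)) (g' m))" if f: "f \<in> cseq.span (insert b B)" for f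
    proof
      fix j
      obtain k where "f - cseq_scale k b \<in> cseq.span B"
        using f unfolding cseq.span_insert by blast
      from decomp[OF this] have eq: "f n - L f n = k * r n" for n
        by (simp add: fun_eq_iff)
      have "(\<Sum>m<Suc d. cseq_scale (f (c' m)) (g' m)) j
          = (\<Sum>m<d. f (c m) * (g m j - g m i * h j)) + f i * h j"
        by (simp add: sum_seq_apply c'_def g'_def)
      also have "\<dots> = L f j + (f i - L f i) * h j"
        by (simp add: L_app algebra_simps sum_subtractf sum_distrib_left sum_distrib_right)
      also have "\<dots> = f j"
        using i eq[of i] eq[of j] by (simp add: h_def diff_eq_eq)
      finally show "f j = (\<Sum>m<Suc d. cseq_scale (f (c' m)) (g' m)) j" by simp
    qed
    moreover have "g' m \<in> lp_space p" for m
      using g h assms(3) by (simp add: g'_def)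
    ultimately show ?thesis by blast
  qed
qed

lemma finite_dim_bracket_small_on_tails:
  assumes p: "1 < p" and F: "lp_fin_dim_subspace p F" and \<eta>: "0 < \<eta>"
  shows "\<exists>n. \<forall>x\<in>lp_unit_sphere p. seq_supp x \<subseteq> {n..} \<longrightarrow>
    (\<forall>f\<in>F. norm (bracket p f x) \<le> \<eta> * lp_norm p f)"
proof -
  obtain B where B: "finite B" "cseq.span B = F" and Fl: "F \<subseteq> lp_space p"
    using F unfolding lp_fin_dim_subspace_def by blast
  then have "B \<subseteq> lp_space p" using cseq.span_superset by blast
  then obtain d :: nat and c g where g: "\<And>m. m < d \<Longrightarrow> g m \<in> lp_space p"
    and rep: "\<And>f. f \<in> F \<Longrightarrow> f = (\<Sum>m<d. cseq_scale (f (c m)) (g m))"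
    using finite_dim_coordinate_representation[OF B(1), of p] p unfolding B(2)
    by (metis less_imp_le less_trans zero_less_one)
  \<comment> \<open>Each of the \<open>d\<close> coefficients has modulus at most \<open>lp_norm p f\<close>; the successor covers \<open>d = 0\<close>.\<close>
  let ?\<delta> = "\<eta> / real (Suc d)"
  have ev: "\<forall>m\<in>{..<d}. eventually (\<lambda>n. \<forall>x\<in>lp_unit_sphere p. seq_supp x \<subseteq> {n..} \<longrightarrow> norm (bracket p (g m) x) < ?\<delta>) sequentially"
  proof
    fix m assume "m \<in> {..<d}"
    then obtain n where n: "\<And>x. x \<in> lp_unit_sphere p \<Longrightarrow> seq_supp x \<subseteq> {n..} \<Longrightarrow> norm (bracket p (g m) x) < ?\<delta>"
      using bracket_small_on_tails[OF p g, of m ?\<delta>] \<eta> by auto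
    show "eventually (\<lambda>n. \<forall>x\<in>lp_unit_sphere p. seq_supp x \<subseteq> {n..} \<longrightarrow> norm (bracket p (g m) x) < ?\<delta>) sequentially"
      using eventually_ge_at_top[of n]
      by eventually_elim (meson atLeast_subset_iff n order_trans)
  qed
  then obtain n where n: "\<And>m x. m < d \<Longrightarrow> x \<in> lp_unit_sphere p \<Longrightarrow> seq_supp x \<subseteq> {n..} \<Longrightarrow> norm (bracket p (g m) x) < ?\<delta>"
    using eventually_happens'[OF sequentially_bot eventually_ball_finite[OF finite_lessThan ev]] by blast
  have "norm (bracket p f x) \<le> \<eta> * lp_norm p f"
    if x: "x \<in> lp_unit_sphere p" "seq_supp x \<subseteq> {n..}" and f: "f \<in> F" for x f
  proof -
    have xl: "x \<in> lp_space p" using lp_unit_sphereD x by blast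
    have "lp_operator p (\<lambda>w. w)"
      unfolding lp_operator_def by (intro conjI exI[of _ 1]) auto
    from bracket_operator_in_lp_dual[OF p this xl] have "(\<lambda>w. bracket p w x) \<in> lp_dual p" .
    then have "bracket p (\<Sum>m<d. cseq_scale (f (c m)) (g m)) x = (\<Sum>m<d. f (c m) * bracket p (g m) x)"
      using p g by (intro lp_dual_sum) auto
    then have "norm (bracket p f x) \<le> (\<Sum>m<d. norm (f (c m) * bracket p (g m) x))"
      using rep[OF f] norm_sum by metis
    also have "\<dots> \<le> (\<Sum>m<d. lp_norm p f * ?\<delta>)"
      using f Fl p n[OF _ x] unfolding norm_mult
      by (intro sum_mono mult_mono coord_le_lp_norm) (auto intro: less_imp_le)
    also have "\<dots> = (real d / real (Suc d)) * (\<eta> * lp_norm p f)" by simp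
    also have "\<dots> \<le> 1 * (\<eta> * lp_norm p f)"
      using \<eta> by (intro mult_right_mono) auto
    finally show ?thesis by simp
  qed
  then show ?thesis by (intro exI[of _ n] ballI impI)
qed

text \<open>
More vectors than the codimension are linearly dependent modulo \<open>M\<close>. The proof is Gaussian
elimination: if the component of some \<open>v e\<close> along \<open>b \<in> B\<close> is nonzero, subtracting multiples of \<open>v e\<close>
removes \<open>b\<close> from all the others, at the price of one vector.
\<close>

lemma (in vector_space) combination_in_finite_codim_subspace:
  assumes "finite B" "subspace M" "finite I" "card B < card I" "\<And>i. i \<in> I \<Longrightarrow> v i \<in> span (M \<union> B)"
  shows "\<exists>a. (\<exists>i\<in>I. a i \<noteq> 0) \<and> (\<Sum>i\<in>I. scale (a i) (v i)) \<in> M"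
  using assms(1,3-)
proof (induction B arbitrary: I v)
  case empty
  have "span (M \<union> {}) \<subseteq> M" by (rule span_minimal) (simp_all add: assms(2))
  then have "v i \<in> M" if "i \<in> I" for i
    using empty.prems(3)[OF that] by (rule subsetD)
  then have "(\<Sum>i\<in>I. scale 1 (v i)) \<in> M"
    by (intro subspace_sum assms(2) subspace_scale)
  moreover have "I \<noteq> {}" using empty.prems(2) by auto
  ultimately show ?case by (intro exI[of _ "\<lambda>_. 1"]) auto
next
  case (insert b B)
  have "\<exists>k. v i - scale k b \<in> span (M \<union> B)" if "i \<in> I" for i
    using insert.prems(3)[OF that] by (simp add: span_insert)
  then obtain k where k: "\<And>i. i \<in> I \<Longrightarrow> v i - scale (k i) b \<in> span (M \<union> B)" by metis
  show ?case
  proof (cases "\<forall>i\<in>I. k i = 0")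
    case True
    then have "v i \<in> span (M \<union> B)" if "i \<in> I" for i using k[OF that] that by simp
    moreover have "card B < card I" using insert.prems(2) insert.hyps by simp
    ultimately show ?thesis using insert.IH insert.prems(1) by blast
  next
    case False
    then obtain e where e: "e \<in> I" "k e \<noteq> 0" by blast
    let ?v = "\<lambda>i. v i - scale (k i / k e) (v e)"
    have "?v i \<in> span (M \<union> B)" if "i \<in> I - {e}" for i
    proof -
      have "(v i - scale (k i) b) - scale (k i / k e) (v e - scale (k e) b) \<in> span (M \<union> B)"
        using that e by (intro span_diff span_scale k) auto
      then show ?thesis using e(2) by (simp add: scale_right_diff_distrib)
    qed
    moreover have "card B < card (I - {e})"
      using insert.prems(1,2) insert.hyps e by simp
    ultimately obtain a where a: "\<exists>i\<in>I - {e}. a i \<noteq> 0" "(\<Sum>i\<in>I - {e}. scale (a i) (?v i)) \<in> M"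
      using insert.IH[of "I - {e}" ?v] insert.prems(1) by auto
    \<comment> \<open>The coefficient of \<open>v e\<close> collects the multiples that the elimination subtracted.\<close>
    define a' where "a' = a(e := - (\<Sum>i\<in>I - {e}. a i * (k i / k e)))"
    have "(\<Sum>i\<in>I. scale (a' i) (v i)) = scale (a' e) (v e) + (\<Sum>i\<in>I - {e}. scale (a i) (v i))"
      by (simp add: sum.remove[OF insert.prems(1) e(1)] a'_def)
    also have "\<dots> = (\<Sum>i\<in>I - {e}. scale (a i) (?v i))"
      by (simp add: a'_def scale_right_diff_distrib sum_subtractf scale_sum_left)
    finally show ?thesis using a by (intro exI[of _ a']) (auto simp: a'_def)
  qed
qed

section \<open>Weakly null nets and tail blocks\<close>

text \<open>
For \<open>x = v + r\<close> with disjoint supports, \<open>[Tx, x] = [Tv, v] + [Tv, r] + [Tr, x]\<close>, where the last two terms are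
at most \<open>K \<rho>\<^sup>p\<^sup>-\<^sup>1\<close> and \<open>K \<rho>\<close>. Passing from \<open>v\<close> to \<open>w = v / \<parallel>v\<parallel>\<close> divides \<open>[Tv, v]\<close> by \<open>\<parallel>v\<parallel>\<^sup>p = 1 - \<parallel>r\<parallel>\<^sup>p\<close>, which
costs another \<open>K \<rho>\<^sup>p\<close>. The bound does not depend on \<open>x\<close>, so \<open>\<rho>\<close> can be fixed before \<open>x\<close> is chosen.
\<close>

lemma normalized_block_bracket:
  assumes p: "1 < p" and T: "lp_operator p T"
    and K: "0 \<le> K" "\<forall>x\<in>lp_space p. \<forall>y\<in>lp_space p.
      norm (bracket p (T x) y) \<le> K * lp_norm p x * lp_norm p y powr (p - 1)"
    and x: "v + r \<in> lp_unit_sphere p" and v: "v \<in> lp_space p" and r: "r \<in> lp_space p"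
    and disj: "seq_supp v \<inter> seq_supp r = {}"
    and \<rho>: "0 \<le> \<rho>" "\<rho> < 1" "lp_norm p r \<le> \<rho>"
  shows "\<exists>w\<in>lp_unit_sphere p. seq_supp w \<subseteq> seq_supp v \<and>
    norm (bracket p (T w) w - bracket p (T (v + r)) (v + r)) \<le> K * (\<rho> + \<rho> powr (p - 1) + \<rho> powr p)"
proof -
  have p0: "0 < p" using p by simp
  have xl: "v + r \<in> lp_space p" "lp_norm p (v + r) = 1" "lp_modular p (v + r) = 1"
    using x lp_unit_sphere_iff_modular[OF p0] lp_unit_sphereD by blast+
  define a where "a = lp_modular p v"
  have r_small: "lp_modular p r \<le> \<rho> powr p"
    unfolding lp_modular_eq_norm[OF p0 r] using \<rho> p0 by (intro powr_mono2) auto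
  have a_eq: "a = 1 - lp_modular p r"
    using lp_modular_disjoint_add[OF disj v r] xl(3) by (simp add: a_def)
  have "\<rho> powr p < 1"
    using powr_less_mono2[OF p0 \<rho>(1,2)] by simp
  then have a: "0 < a" "a \<le> 1" "1 - a \<le> \<rho> powr p"
    using a_eq r_small lp_modular_nonneg[OF r] by auto
  define t where "t = lp_norm p v"
  have t: "t powr p = a" by (simp add: t_def a_def lp_modular_eq_norm[OF p0 v])
  have t0: "0 < t" using t a(1) p0 lp_norm_nonneg[of p v] by (cases "t = 0") (auto simp: t_def less_le)
  have t1: "t \<le> 1"
    using a(2) powr_mono2[of "1/p" a 1] p0 by (simp add: t_def lp_norm_eq_modular a_def lp_modular_nonneg[OF v])
  have "v \<noteq> 0" using t0 by (auto simp: t_def)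
  define w where "w = cseq_scale (complex_of_real (1 / t)) v"
  have w: "w \<in> lp_unit_sphere p"
    unfolding w_def t_def by (rule normalize_in_lp_unit_sphere[OF p0 v \<open>v \<noteq> 0\<close>])
  have wl: "w \<in> lp_space p" "lp_norm p w = 1" using w lp_unit_sphereD by blast+
  have "v = cseq_scale (complex_of_real t) w"
    using t0 by (simp add: w_def fun_eq_iff)
  then have "bracket p (T v) v = of_real a * bracket p (T w) w"
    using bracket_operator_scale[OF p T wl(1), of "complex_of_real t"] t t0 by (simp only: norm_of_real) simp
  moreover have "bracket p (T (v + r)) (v + r) = bracket p (T v) (v + r) + bracket p (T r) (v + r)"
    by (rule lp_dual_add[OF bracket_operator_in_lp_dual[OF p T xl(1)] v r])
  moreover have "bracket p (T v) (v + r) = bracket p (T v) v + bracket p (T v) r"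
    by (rule bracket_disjoint_add_right[OF p disj v r lp_operator_space[OF T v]])
  ultimately have eq: "bracket p (T w) w - bracket p (T (v + r)) (v + r)
      = of_real (1 - a) * bracket p (T w) w - bracket p (T v) r - bracket p (T r) (v + r)"
    by (simp add: algebra_simps)
  have "norm (of_real (1 - a) * bracket p (T w) w) \<le> \<rho> powr p * K"
    unfolding norm_mult norm_of_real using a bspec[OF bspec[OF K(2) wl(1)] wl(1)] wl(2) by (intro mult_mono) auto
  moreover have "norm (bracket p (T v) r) \<le> K * \<rho> powr (p - 1)"
  proof -
    have "norm (bracket p (T v) r) \<le> K * t * lp_norm p r powr (p - 1)"
      using bspec[OF bspec[OF K(2) v] r] by (simp add: t_def)
    also have "\<dots> \<le> K * 1 * \<rho> powr (p - 1)"
      using K(1) t1 t0 \<rho> p by (intro mult_mono powr_mono2) auto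
    finally show ?thesis by simp
  qed
  moreover have "norm (bracket p (T r) (v + r)) \<le> K * \<rho>"
    using bspec[OF bspec[OF K(2) r] xl(1)] xl(2) mult_left_mono[OF \<rho>(3) K(1)] by simp
  ultimately have "norm (bracket p (T w) w - bracket p (T (v + r)) (v + r)) \<le> K * (\<rho> + \<rho> powr (p - 1) + \<rho> powr p)"
    unfolding eq
    using norm_triangle_ineq4[of "of_real (1 - a) * bracket p (T w) w - bracket p (T v) r" "bracket p (T r) (v + r)"]
      norm_triangle_ineq4[of "of_real (1 - a) * bracket p (T w) w" "bracket p (T v) r"]
    by (simp add: algebra_simps)
  moreover have "seq_supp w \<subseteq> seq_supp v" unfolding w_def by (rule seq_supp_scale)
  ultimately show ?thesis using w by blast
qed

text \<open>
The decomposition \<open>x = v + r\<close> cuts off the coordinates before \<open>k\<close>, which are small along the net, and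
those from a late index \<open>n\<close> on, which are small for the single vector \<open>x\<close>. Each part may contribute
half of \<open>\<rho>\<^sup>p\<close> to the modular of \<open>r\<close>.
\<close>

lemma tail_block_of_weakly_null:
  assumes p: "1 < p" and T: "lp_operator p T"
    and N: "N \<noteq> bot" "N \<le> principal (lp_unit_sphere p)" "\<And>\<phi>. \<phi> \<in> lp_dual p \<Longrightarrow> (\<phi> \<longlongrightarrow> 0) N"
    and lim: "((\<lambda>x. bracket p (T x) x) \<longlongrightarrow> l) N" and \<epsilon>: "0 < \<epsilon>"
  shows "\<exists>w\<in>lp_unit_sphere p. finite (seq_supp w) \<and> seq_supp w \<subseteq> {k..} \<and> norm (bracket p (T w) w - l) < \<epsilon>"
proof -
  have p0: "0 < p" using p by simp
  obtain K where K: "0 \<le> K" "\<forall>x\<in>lp_space p. \<forall>y\<in>lp_space p.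
      norm (bracket p (T x) y) \<le> K * lp_norm p x * lp_norm p y powr (p - 1)"
    using lp_operator_bracket_bound[OF p T] by blast
  have "((\<lambda>\<rho>. K * (\<rho> + \<rho> powr (p - 1) + \<rho> powr p)) \<longlongrightarrow> K * (0 + 0 powr (p - 1) + 0 powr p)) (at_right 0)"
    using p by (intro tendsto_intros tendsto_powr') (auto simp: eventually_at_right_less intro: eventually_mono[OF eventually_at_right_less])
  then have "((\<lambda>\<rho>. K * (\<rho> + \<rho> powr (p - 1) + \<rho> powr p)) \<longlongrightarrow> 0) (at_right 0)"
    by simp
  from order_tendstoD(2)[OF this, of "\<epsilon> / 2"] \<epsilon>
  have "eventually (\<lambda>\<rho>. K * (\<rho> + \<rho> powr (p - 1) + \<rho> powr p) < \<epsilon> / 2) (at_right 0)" by simp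
  moreover have "eventually (\<lambda>\<rho>::real. \<rho> \<in> {0<..<1}) (at_right 0)"
    by (rule eventually_at_right_real) simp
  ultimately have "eventually (\<lambda>\<rho>. K * (\<rho> + \<rho> powr (p - 1) + \<rho> powr p) < \<epsilon> / 2 \<and> \<rho> \<in> {0<..<1}) (at_right 0)"
    by (rule eventually_conj)
  then obtain \<rho> :: real where \<rho>: "K * (\<rho> + \<rho> powr (p - 1) + \<rho> powr p) < \<epsilon> / 2" "0 < \<rho>" "\<rho> < 1"
    using eventually_happens'[OF trivial_limit_at_right_real] by (auto simp: greaterThanLessThan_iff)
  have \<rho>p: "0 < \<rho> powr p / 2" using \<rho>(2) by simp
  have "((\<lambda>x. \<Sum>j<k. norm (x j) powr p) \<longlongrightarrow> (\<Sum>j<k. 0 powr p)) N"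
    using p0 by (intro tendsto_sum tendsto_powr' tendsto_norm_zero N(3) coordinate_in_lp_dual tendsto_const) auto
  then have "((\<lambda>x. \<Sum>j<k. norm (x j) powr p) \<longlongrightarrow> 0) N" by simp
  from order_tendstoD(2)[OF this \<rho>p]
  have "eventually (\<lambda>x. (\<Sum>j<k. norm (x j) powr p) < \<rho> powr p / 2) N" .
  moreover have "eventually (\<lambda>x. norm (bracket p (T x) x - l) < \<epsilon> / 2) N"
    using tendstoD[OF lim, of "\<epsilon> / 2"] \<epsilon> by (simp add: dist_norm)
  moreover have "eventually (\<lambda>x. x \<in> lp_unit_sphere p) N"
    using N(2) by (simp add: le_principal)
  ultimately have "eventually (\<lambda>x. (\<Sum>j<k. norm (x j) powr p) < \<rho> powr p / 2 \<and>
      norm (bracket p (T x) x - l) < \<epsilon> / 2 \<and> x \<in> lp_unit_sphere p) N"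
    by eventually_elim simp
  from eventually_happens'[OF N(1) this] obtain x where x: "(\<Sum>j<k. norm (x j) powr p) < \<rho> powr p / 2"
    "norm (bracket p (T x) x - l) < \<epsilon> / 2" "x \<in> lp_unit_sphere p" by blast
  have xl: "x \<in> lp_space p" using x(3) lp_unit_sphereD by blast
  let ?tail = "\<lambda>n j. if n \<le> j then x j else 0"
  have tl: "?tail n \<in> lp_space p" for n
    using p0 by (intro lp_space_dominated[OF xl]) auto
  have "((\<lambda>n. lp_norm p (?tail n) powr p) \<longlongrightarrow> 0 powr p) sequentially"
    using p0 by (intro tendsto_powr' lp_norm_tail_tendsto_0[OF p0 xl] tendsto_const) auto
  then have "((\<lambda>n. lp_modular p (?tail n)) \<longlongrightarrow> 0) sequentially"
    using lp_modular_eq_norm[OF p0 tl] by simp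
  from eventually_conj[OF order_tendstoD(2)[OF this \<rho>p] eventually_ge_at_top[of k]]
  obtain n where n: "lp_modular p (?tail n) < \<rho> powr p / 2" "k \<le> n"
    using eventually_happens'[OF sequentially_bot] by blast
  define h where "h j = (if j < k then x j else 0)" for j
  define v where "v j = (if k \<le> j \<and> j < n then x j else 0)" for j
  define r where "r = h + ?tail n"
  have fin: "finite (seq_supp h)" "finite (seq_supp v)"
    by (auto intro: finite_subset[of _ "{..<k}"] finite_subset[of _ "{..<n}"] simp: h_def v_def seq_supp_def split: if_splits)
  have vr: "v + r = x"
    using n(2) by (auto simp: v_def r_def h_def fun_eq_iff)
  have rl: "r \<in> lp_space p" unfolding r_def
    by (intro lp_space_add lp_space_finite_support fin tl) (use p0 in simp)
  have "lp_modular p h = (\<Sum>j<k. norm (x j) powr p)"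
    unfolding lp_modular_def by (subst suminf_finite[of "{..<k}"]) (auto simp: h_def)
  moreover have "lp_modular p r = lp_modular p h + lp_modular p (?tail n)"
    unfolding r_def using n(2)
    by (intro lp_modular_disjoint_add lp_space_finite_support fin tl) (auto simp: h_def seq_supp_def)
  ultimately have "lp_modular p r \<le> \<rho> powr p" using x(1) n(1) by linarith
  then have "lp_norm p r \<le> (\<rho> powr p) powr (1 / p)"
    unfolding lp_norm_eq_modular using p0 lp_modular_nonneg[OF rl] by (intro powr_mono2) auto
  then have r_small: "lp_norm p r \<le> \<rho>" using \<rho>(2) p0 by (simp add: powr_powr)
  have disj: "seq_supp v \<inter> seq_supp r = {}"
    using n(2) by (auto simp: v_def r_def h_def seq_supp_def split: if_splits)
  obtain w where w: "w \<in> lp_unit_sphere p" "seq_supp w \<subseteq> seq_supp v"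
    "norm (bracket p (T w) w - bracket p (T x) x) \<le> K * (\<rho> + \<rho> powr (p - 1) + \<rho> powr p)"
    using normalized_block_bracket[OF p T K _ lp_space_finite_support[OF fin(2)] rl disj, of \<rho>] x(3) \<rho> r_small
    unfolding vr by auto
  have "norm (bracket p (T w) w - l) \<le> norm (bracket p (T w) w - bracket p (T x) x) + norm (bracket p (T x) x - l)"
    using norm_triangle_ineq[of "bracket p (T w) w - bracket p (T x) x" "bracket p (T x) x - l"] by simp
  then have "norm (bracket p (T w) w - l) < \<epsilon>" using w(3) x(2) \<rho>(1) by linarith
  moreover have "finite (seq_supp w)"
    by (rule finite_subset[OF w(2) fin(2)])
  moreover have "seq_supp w \<subseteq> {k..}"
    using w(2) by (auto simp: v_def seq_supp_def split: if_splits)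
  ultimately show ?thesis using w(1) by blast
qed

text \<open>
The witnessing net is a sequence \<open>X n\<close> of blocks in \<open>{n..}\<close>, weakly null by
\<open>functional_small_on_tails\<close>.
\<close>

lemma ess_num_range_of_tail_blocks:
  assumes p: "1 < p"
    and tails: "\<And>k \<epsilon>. 0 < \<epsilon> \<Longrightarrow> \<exists>x\<in>lp_unit_sphere p. finite (seq_supp x) \<and> seq_supp x \<subseteq> {k..} \<and>
      norm (bracket p (T x) x - l) < \<epsilon>"
  shows "l \<in> ess_num_range p T"
proof -
  have "\<forall>n. \<exists>x. x \<in> lp_unit_sphere p \<and> finite (seq_supp x) \<and> seq_supp x \<subseteq> {n..} \<and>
      norm (bracket p (T x) x - l) < inverse (real (Suc n))"
    using tails[of "inverse (real (Suc n))" n for n] by (simp add: Bex_def)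
  then obtain X where X: "\<And>n. X n \<in> lp_unit_sphere p" "\<And>n. finite (seq_supp (X n))"
    "\<And>n. seq_supp (X n) \<subseteq> {n..}" "\<And>n. norm (bracket p (T (X n)) (X n) - l) < inverse (real (Suc n))"
    by metis
  have "((\<lambda>n. bracket p (T (X n)) (X n) - l) \<longlongrightarrow> 0) sequentially"
    by (rule Lim_null_comparison[OF _ LIMSEQ_inverse_real_of_nat]) (use X(4) in \<open>simp add: less_imp_le del: of_nat_Suc\<close>)
  then have "((\<lambda>x. bracket p (T x) x) \<longlongrightarrow> l) (filtermap X sequentially)"
    by (simp add: filterlim_filtermap Lim_null[symmetric])
  moreover have "(\<phi> \<longlongrightarrow> 0) (filtermap X sequentially)" if \<phi>: "\<phi> \<in> lp_dual p" for \<phi>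
    unfolding tendsto_iff eventually_filtermap
  proof (intro allI impI)
    fix \<eta> :: real assume "0 < \<eta>"
    from functional_small_on_tails[OF p \<phi> this]
    obtain n where n: "\<And>x. x \<in> lp_unit_sphere p \<Longrightarrow> finite (seq_supp x) \<Longrightarrow> seq_supp x \<subseteq> {n..} \<Longrightarrow> norm (\<phi> x) < \<eta>"
      by blast
    have "norm (\<phi> (X m)) < \<eta>" if "n \<le> m" for m
      using X(3)[of m] that by (intro n X) auto
    then show "eventually (\<lambda>m. dist (\<phi> (X m)) 0 < \<eta>) sequentially"
      by (auto simp: eventually_sequentially)
  qed
  moreover have "filtermap X sequentially \<noteq> bot" by (simp add: filtermap_bot_iff)
  moreover have "filtermap X sequentially \<le> principal (lp_unit_sphere p)"
    using X(1) by (simp add: le_principal eventually_filtermap)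
  ultimately show ?thesis unfolding ess_num_range_def by blast
qed

section \<open>Blocks in subspaces of finite codimension\<close>

text \<open>
By homogeneity and disjointness, \<open>[Ty, y] = \<Sum>\<^sub>i\<^sub>,\<^sub>j c\<^sub>j b\<^sub>i [T u\<^sub>i, u\<^sub>j]\<close> with \<open>c\<^sub>j = cnj b\<^sub>j \<bar>b\<^sub>j\<bar>\<^sup>p\<^sup>-\<^sup>2\<close>. As
\<open>\<Sum> c\<^sub>i b\<^sub>i = \<Sum> \<bar>b\<^sub>i\<bar>\<^sup>p = 1\<close>, also \<open>l\<close> is such a double sum, with \<open>l\<close> on the diagonal and \<open>0\<close> off it. The two are
compared entry by entry, where all coefficients have modulus at most \<open>1\<close>.
\<close>

lemma bracket_block_combination:
  assumes p: "1 < p" and T: "lp_operator p T" and I: "finite I"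
    and disj: "disjoint_family_on (\<lambda>i. seq_supp (u i)) I"
    and u: "\<And>i. i \<in> I \<Longrightarrow> u i \<in> lp_unit_sphere p"
    and b: "(\<Sum>i\<in>I. norm (b i) powr p) = 1"
    and diag: "\<And>i. i \<in> I \<Longrightarrow> norm (bracket p (T (u i)) (u i) - l) \<le> \<eta>"
    and off: "\<And>i j. i \<in> I \<Longrightarrow> j \<in> I \<Longrightarrow> i \<noteq> j \<Longrightarrow> norm (bracket p (T (u i)) (u j)) \<le> \<eta>"
  defines "y \<equiv> \<Sum>i\<in>I. cseq_scale (b i) (u i)"
  shows "norm (bracket p (T y) y - l) \<le> real (card I * card I) * \<eta>"
proof -
  have p0: "0 < p" using p by simp
  have ul: "u i \<in> lp_space p" if "i \<in> I" for i using u[OF that] lp_unit_sphereD by blast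
  have yl: "y \<in> lp_space p"
    unfolding y_def using p0 ul by (intro lp_space_sum lp_space_scale) auto
  let ?c = "\<lambda>j. cnj (b j) * of_real (norm (b j) powr (p - 2))"
  let ?d = "\<lambda>i j. if i = j then l else 0"
  have b1: "norm (b i) \<le> 1" if "i \<in> I" for i
  proof -
    have "norm (b i) powr p \<le> 1"
      using member_le_sum[OF that _ I, of "\<lambda>i. norm (b i) powr p"] b by simp
    then show ?thesis
      using powr_less_mono2[OF p0, of 1 "norm (b i)"] by fastforce
  qed
  have c1: "norm (?c i) \<le> 1" if "i \<in> I" for i
  proof -
    have "norm (?c i) = norm (b i) powr (p - 1)"
      using norm_duality_map[OF p, of "\<lambda>_. b i" 0] by (simp add: duality_map_def norm_mult)
    also have "\<dots> \<le> 1 powr (p - 1)" using b1[OF that] p by (intro powr_mono2) auto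
    finally show ?thesis by simp
  qed
  have "bracket p (T y) y = (\<Sum>j\<in>I. bracket p (T y) (cseq_scale (b j) (u j)))"
    unfolding y_def using yl[unfolded y_def]
    by (intro bracket_disjoint_sum_right p I disjoint_family_on_scale disj lp_space_scale ul lp_operator_space[OF T])
  also have "\<dots> = (\<Sum>j\<in>I. ?c j * bracket p (T y) (u j))"
    by (intro sum.cong refl bracket_scale_right p ul lp_operator_space[OF T yl])
  also have "\<dots> = (\<Sum>j\<in>I. \<Sum>i\<in>I. ?c j * b i * bracket p (T (u i)) (u j))"
  proof (intro sum.cong refl)
    fix j assume "j \<in> I"
    have "bracket p (T y) (u j) = (\<Sum>i\<in>I. b i * bracket p (T (u i)) (u j))"
      unfolding y_def using p0 ul
      by (intro lp_dual_sum[OF bracket_operator_in_lp_dual[OF p T ul[OF \<open>j \<in> I\<close>]]]) auto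
    then show "?c j * bracket p (T y) (u j) = (\<Sum>i\<in>I. ?c j * b i * bracket p (T (u i)) (u j))"
      by (simp add: sum_distrib_left mult.assoc)
  qed
  finally have e1: "bracket p (T y) y = (\<Sum>j\<in>I. \<Sum>i\<in>I. ?c j * b i * bracket p (T (u i)) (u j))" .
  have "l = of_real (\<Sum>j\<in>I. norm (b j) powr p) * l" by (simp add: b)
  also have "\<dots> = (\<Sum>j\<in>I. ?c j * b j * l)"
    unfolding of_real_sum sum_distrib_right
    by (intro sum.cong refl) (simp only: mult_cnj_norm_powr[OF p, symmetric] mult.commute[of "b _"])
  also have "\<dots> = (\<Sum>j\<in>I. \<Sum>i\<in>I. ?c j * b i * ?d i j)"
    using I by (intro sum.cong refl) (simp add: if_distrib[of "\<lambda>z. _ * z"] sum.delta cong: if_cong)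
  finally have e2: "l = (\<Sum>j\<in>I. \<Sum>i\<in>I. ?c j * b i * ?d i j)" .
  have "bracket p (T y) y - l = (\<Sum>j\<in>I. \<Sum>i\<in>I. ?c j * b i * (bracket p (T (u i)) (u j) - ?d i j))"
    unfolding e1 by (subst e2) (simp only: sum_subtractf[symmetric] right_diff_distrib[symmetric])
  also have "norm \<dots> \<le> (\<Sum>j\<in>I. \<Sum>i\<in>I. 1 * 1 * \<eta>)"
  proof (intro sum_norm_le)
    fix j i assume ij: "j \<in> I" "i \<in> I"
    have "norm (bracket p (T (u i)) (u j) - ?d i j) \<le> \<eta>"
      using diag[OF ij(1)] off[OF ij(2,1)] by auto
    then show "norm (?c j * b i * (bracket p (T (u i)) (u j) - ?d i j)) \<le> 1 * 1 * \<eta>"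
      unfolding norm_mult[of "?c j * b i"] norm_mult[of "?c j" "b i"]
      using b1[OF ij(2)] c1[OF ij(1)] by (intro mult_mono) auto
  qed
  finally show ?thesis by (simp add: mult.assoc)
qed

text \<open>
The blocks all lie in \<open>{k..}\<close>, and hence so does the vector found in \<open>M\<close>; with \<open>k\<close> far out, this is
what makes the pairing with a finite-dimensional space small.
\<close>

lemma fin_codim_vector_of_tail_blocks:
  assumes p: "1 < p" and T: "lp_operator p T"
    and tails: "\<And>k \<epsilon>. 0 < \<epsilon> \<Longrightarrow> \<exists>x\<in>lp_unit_sphere p. finite (seq_supp x) \<and> seq_supp x \<subseteq> {k..} \<and>
      norm (bracket p (T x) x - l) < \<epsilon>"
    and M: "cseq.subspace M" "finite B" "cseq.span (M \<union> B) = lp_space p" and \<epsilon>: "0 < \<epsilon>"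
  shows "\<exists>x\<in>lp_unit_sphere p. x \<in> M \<and> finite (seq_supp x) \<and> seq_supp x \<subseteq> {k..} \<and>
    norm (bracket p (T x) x - l) < \<epsilon>"
proof -
  have p0: "0 < p" using p by simp
  define n where "n = Suc (card B)"
  \<comment> \<open>The double sum over the \<open>n\<close> blocks has \<open>n * n\<close> entries, each off by at most \<open>\<eta>\<close>; the successor
    makes the total strictly less than \<open>\<epsilon>\<close>.\<close>
  define \<eta> where "\<eta> = \<epsilon> / real (Suc (n * n))"
  have \<eta>: "0 < \<eta>" using \<epsilon> by (simp add: \<eta>_def del: of_nat_Suc)
  define P where "P x \<longleftrightarrow> x \<in> lp_unit_sphere p \<and> seq_supp x \<subseteq> {k..} \<and> norm (bracket p (T x) x - l) < \<eta>" for x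
  define R where "R x y \<longleftrightarrow> norm (bracket p (T x) y) < \<eta> \<and> norm (bracket p (T y) x) < \<eta>" for x y
  have ex: "\<exists>x. P x \<and> finite (seq_supp x) \<and> seq_supp x \<subseteq> {m..}" for m
    using tails[OF \<eta>, of "max k m"] by (force simp: P_def)
  have tail: "\<exists>m. \<forall>y. P y \<longrightarrow> finite (seq_supp y) \<longrightarrow> seq_supp y \<subseteq> {m..} \<longrightarrow> R x y" if "P x" for x
  proof -
    have xl: "x \<in> lp_space p" using that lp_unit_sphereD by (auto simp: P_def)
    obtain m1 where m1: "\<forall>y\<in>lp_unit_sphere p. seq_supp y \<subseteq> {m1..} \<longrightarrow> norm (bracket p (T x) y) < \<eta>"
      using bracket_small_on_tails[OF p lp_operator_space[OF T xl] \<eta>] by blast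
    obtain m2 where m2: "\<forall>y\<in>lp_unit_sphere p. finite (seq_supp y) \<longrightarrow> seq_supp y \<subseteq> {m2..} \<longrightarrow> norm (bracket p (T y) x) < \<eta>"
      using functional_small_on_tails[OF p bracket_operator_in_lp_dual[OF p T xl] \<eta>] by blast
    have "R x y" if "P y" "finite (seq_supp y)" "seq_supp y \<subseteq> {max m1 m2..}" for y
    proof -
      have "seq_supp y \<subseteq> {m1..}" "seq_supp y \<subseteq> {m2..}" using that(3) by force+
      then show ?thesis using that(1,2) m1 m2 by (auto simp: P_def R_def)
    qed
    then show ?thesis by blast
  qed
  from block_sequence[of P R, OF ex tail]
  obtain u :: "nat \<Rightarrow> nat \<Rightarrow> complex" where u: "\<And>i. P (u i)" "\<And>i. finite (seq_supp (u i))"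
    "disjoint_family (\<lambda>i. seq_supp (u i))" and uR: "\<And>i j. i < j \<Longrightarrow> R (u i) (u j)"
    by blast
  have us: "u i \<in> lp_unit_sphere p" for i using u(1) by (simp add: P_def)
  have ul: "u i \<in> lp_space p" for i using us lp_unit_sphereD by blast
  have off: "norm (bracket p (T (u i)) (u j)) < \<eta>" if "i \<noteq> j" for i j
    using uR[of i j] uR[of j i] that by (cases "i < j") (auto simp: R_def)
  have disj: "disjoint_family_on (\<lambda>i. seq_supp (u i)) {..<n}"
    by (rule disjoint_family_on_mono[OF subset_UNIV u(3)])
  have "card B < card {..<n}" by (simp add: n_def)
  moreover have "u i \<in> cseq.span (M \<union> B)" for i using ul by (simp only: M(3))
  ultimately obtain a where a: "\<exists>i\<in>{..<n}. a i \<noteq> 0" "(\<Sum>i<n. cseq_scale (a i) (u i)) \<in> M"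
    using cseq.combination_in_finite_codim_subspace[OF M(2,1) finite_lessThan, of n u] by blast
  define s where "s = (\<Sum>i<n. norm (a i) powr p)"
  have s: "0 < s"
  proof -
    obtain i where i: "i < n" "a i \<noteq> 0" using a(1) by blast
    have "0 < norm (a i) powr p" using i(2) by simp
    also have "\<dots> \<le> s" unfolding s_def
      using i(1) by (intro member_le_sum) auto
    finally show ?thesis .
  qed
  define t where "t = s powr (1 / p)"
  have t: "0 < t" "t powr p = s" using s p0 by (auto simp: t_def powr_powr)
  define b where "b i = complex_of_real (1 / t) * a i" for i
  define y where "y = (\<Sum>i<n. cseq_scale (b i) (u i))"
  have bn: "(\<Sum>i<n. norm (b i) powr p) = 1"
  proof -
    have "norm (b i) powr p = norm (a i) powr p / s" for i
      using t by (simp add: b_def norm_mult norm_divide powr_divide)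
    then show ?thesis using s by (simp add: s_def flip: sum_divide_distrib)
  qed
  have "y = cseq_scale (complex_of_real (1 / t)) (\<Sum>i<n. cseq_scale (a i) (u i))"
    by (simp only: y_def b_def cseq.scale_sum_right cseq.scale_scale)
  then have yM: "y \<in> M" using cseq.subspace_scale[OF M(1) a(2)] by (simp only:)
  have yl: "y \<in> lp_space p"
    unfolding y_def using p0 ul by (intro lp_space_sum lp_space_scale) auto
  have "lp_modular p y = 1"
    unfolding y_def using lp_modular_block_combination[OF p0 finite_lessThan disj us] bn by simp
  then have ys: "y \<in> lp_unit_sphere p" using yl by (simp add: lp_unit_sphere_iff_modular[OF p0])
  have supp: "seq_supp y \<subseteq> (\<Union>i<n. seq_supp (u i))"
  proof
    fix j assume "j \<in> seq_supp y"
    then have "(\<Sum>i<n. b i * u i j) \<noteq> 0" by (simp add: seq_supp_def y_def sum_seq_apply)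
    then obtain i where "i \<in> {..<n}" "b i * u i j \<noteq> 0" by (rule sum.not_neutral_contains_not_neutral)
    then show "j \<in> (\<Union>i<n. seq_supp (u i))" by (auto simp: seq_supp_def)
  qed
  have "norm (bracket p (T y) y - l) \<le> real (card {..<n} * card {..<n}) * \<eta>"
    unfolding y_def using u(1) off
    by (intro bracket_block_combination[OF p T finite_lessThan disj us bn]) (auto simp: P_def intro: less_imp_le)
  also have "\<dots> < real (Suc (n * n)) * \<eta>" using \<eta> by (intro mult_strict_right_mono) auto
  also have "\<dots> = \<epsilon>" by (simp add: \<eta>_def del: of_nat_Suc)
  finally have "norm (bracket p (T y) y - l) < \<epsilon>" .
  moreover have "seq_supp y \<subseteq> {k..}" using supp u(1) by (fastforce simp: P_def)
  moreover have "finite (seq_supp y)" using supp u(2) by (rule_tac finite_subset) auto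
  ultimately show ?thesis using ys yM by blast
qed

section \<open>Equivalence of the three conditions\<close>

text \<open>
When \<open>F \<noteq> {0}\<close>, the supremum runs over a nonempty set, because \<open>F\<close> contains a normalised vector; so a
common bound on the pairings is a bound on the supremum. Half of \<open>\<epsilon>\<close> in the hypothesis makes the
conclusion strict.
\<close>

lemma pairing_sup_less:
  assumes p: "1 < p" and F: "lp_fin_dim_subspace p F" and \<epsilon>: "0 < \<epsilon>"
    and le: "\<And>f. f \<in> F \<Longrightarrow> norm (pairing f y) \<le> \<epsilon> / 2 * lp_norm p f"
  shows "pairing_sup p F y < \<epsilon>"
proof (cases "F = {0}")
  case False
  have sub: "cseq.subspace F" "F \<subseteq> lp_space p" using F by (auto simp: lp_fin_dim_subspace_def)
  then obtain f where f: "f \<in> F" "f \<noteq> 0" using False cseq.subspace_0 by blast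
  let ?f = "cseq_scale (complex_of_real (1 / lp_norm p f)) f"
  have "?f \<in> F" by (rule cseq.subspace_scale[OF sub(1) f(1)])
  moreover have "lp_norm p ?f = 1"
    using normalize_in_lp_unit_sphere[of p f] p f sub(2) lp_unit_sphereD(2) by (simp add: subset_iff del: cseq_scale_apply)
  ultimately have ne: "{f \<in> F. lp_norm p f = 1} \<noteq> {}" by blast
  have "(SUP f\<in>{f \<in> F. lp_norm p f = 1}. norm (pairing f y)) \<le> \<epsilon> / 2"
    by (rule cSUP_least[OF ne]) (use le in force)
  then show ?thesis using False \<epsilon> by (simp add: pairing_sup_def)
qed (simp add: pairing_sup_def \<epsilon>)

text \<open>
The complement is open because \<open>\<bar>x j - y j\<bar> \<le> \<parallel>x - y\<parallel>\<close>, and the first \<open>k + 1\<close> unit vectors span a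
complementary subspace.
\<close>

lemma fin_codim_vanishing_initial_coordinates:
  assumes p: "1 < p"
  shows "lp_closed_fin_codim_subspace p {x \<in> lp_space p. \<forall>j\<le>k. x j = 0}" (is "lp_closed_fin_codim_subspace p ?M")
  unfolding lp_closed_fin_codim_subspace_def
proof (intro conjI)
  have p0: "0 < p" using p by simp
  interpret Metric_space "lp_space p" "lp_dist p" by (rule Metric_space_lp[OF p])
  show sub: "cseq.subspace ?M" using p0 by (auto simp: cseq.subspace_def)
  show "?M \<subseteq> lp_space p" by blast
  show "closedin mtopology ?M"
    unfolding closedin_metric
  proof (intro conjI allI impI)
    fix x assume "x \<in> lp_space p - ?M"
    then obtain j where x: "x \<in> lp_space p" and j: "j \<le> k" "x j \<noteq> 0" by blast
    have "y \<notin> ?M" if "y \<in> mball x (norm (x j))" for y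
    proof
      assume "y \<in> ?M"
      then have "y \<in> lp_space p" "y j = 0" using j(1) by auto
      then have "norm (x j) \<le> lp_dist p x y"
        using coord_le_lp_norm[of p "x - y" j] x p0 by (simp add: lp_dist_def)
      then show False using that by simp
    qed
    then show "\<exists>r>0. disjnt ?M (mball x r)"
      using j(2) by (intro exI[of _ "norm (x j)"]) (simp add: disjnt_iff del: in_mball, blast)
  qed blast
  define e :: "nat \<Rightarrow> nat \<Rightarrow> complex" where "e j i = (if i = j then 1 else 0)" for j i
  have e: "e j \<in> lp_space p" for j
    by (rule lp_space_finite_support) (simp add: seq_supp_def e_def)
  have "cseq.span (?M \<union> e ` {..k}) = lp_space p"
  proof
    show "cseq.span (?M \<union> e ` {..k}) \<subseteq> lp_space p"
      using e p0 by (intro cseq.span_minimal subspace_lp_space) auto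
    show "lp_space p \<subseteq> cseq.span (?M \<union> e ` {..k})"
    proof
      fix x assume x: "x \<in> lp_space p"
      let ?s = "\<Sum>j\<le>k. cseq_scale (x j) (e j)"
      have s: "?s i = (if i \<le> k then x i else 0)" for i
        by (simp add: sum_seq_apply e_def if_distrib[of "\<lambda>z. _ * z"] sum.delta' cong: if_cong)
      have "x - ?s \<in> lp_space p"
        using p0 x e by (intro lp_space_diff lp_space_sum lp_space_scale) auto
      then have "x - ?s \<in> ?M" using s by simp
      then have "x - ?s \<in> cseq.span (?M \<union> e ` {..k})" by (intro cseq.span_base UnI1)
      moreover have "?s \<in> cseq.span (?M \<union> e ` {..k})"
        by (intro cseq.span_sum cseq.span_scale cseq.span_base) auto
      ultimately have "(x - ?s) + ?s \<in> cseq.span (?M \<union> e ` {..k})" by (rule cseq.span_add)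
      then show "x \<in> cseq.span (?M \<union> e ` {..k})" by (simp only: diff_add_cancel)
    qed
  qed
  then show "\<exists>B. finite B \<and> cseq.span (?M \<union> B) = lp_space p" by (intro exI[of _ "e ` {..k}"]) simp
qed

theorem theorem3p4:
  fixes p :: real and T :: "(nat \<Rightarrow> complex) \<Rightarrow> (nat \<Rightarrow> complex)" and l :: complex
  assumes "1 < p" and "lp_operator p T"
  shows "(l \<in> ess_num_range p T \<longleftrightarrow>
           (\<forall>k::nat. \<forall>\<epsilon>>0. \<exists>x\<in>lp_unit_sphere p.
              finite (seq_supp x) \<and> seq_supp x \<subseteq> {k + 1..} \<and>
              norm (pairing (T x) (duality_map p x) - l) < \<epsilon>)) \<and>
         (l \<in> ess_num_range p T \<longleftrightarrow>
           (\<forall>M F. lp_closed_fin_codim_subspace p M \<longrightarrow> lp_fin_dim_subspace p F \<longrightarrow>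
              (\<forall>\<epsilon>>0. \<exists>x\<in>lp_unit_sphere p.
                 x \<in> M \<and> finite (seq_supp x) \<and>
                 norm (pairing (T x) (duality_map p x) - l) < \<epsilon> \<and>
                 pairing_sup p F (duality_map p x) < \<epsilon>)))"
    (is "(?i \<longleftrightarrow> ?ii) \<and> (?i \<longleftrightarrow> ?iii)")
proof -
  note p = assms(1) and T = assms(2)
  have i_ii: "?ii" if ?i
  proof (intro allI impI)
    fix k :: nat and \<epsilon> :: real assume "0 < \<epsilon>"
    obtain N where "N \<noteq> bot" "N \<le> principal (lp_unit_sphere p)" "\<forall>\<phi>\<in>lp_dual p. (\<phi> \<longlongrightarrow> 0) N"
      "((\<lambda>x. bracket p (T x) x) \<longlongrightarrow> l) N"
      using \<open>?i\<close> unfolding ess_num_range_def by blast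
    then show "\<exists>x\<in>lp_unit_sphere p. finite (seq_supp x) \<and> seq_supp x \<subseteq> {k + 1..} \<and>
        norm (bracket p (T x) x - l) < \<epsilon>"
      using tail_block_of_weakly_null[OF p T, of N l \<epsilon> "k + 1"] \<open>0 < \<epsilon>\<close> by blast
  qed
  have ii_i_iii: "?i \<and> ?iii" if ?ii
  proof -
    have tails: "\<exists>x\<in>lp_unit_sphere p. finite (seq_supp x) \<and> seq_supp x \<subseteq> {k..} \<and>
        norm (bracket p (T x) x - l) < \<epsilon>" if "0 < \<epsilon>" for k :: nat and \<epsilon> :: real
    proof -
      obtain x where "x \<in> lp_unit_sphere p" "finite (seq_supp x)" "seq_supp x \<subseteq> {k + 1..}"
        "norm (bracket p (T x) x - l) < \<epsilon>"
        using \<open>?ii\<close> \<open>0 < \<epsilon>\<close> by blast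
      then show ?thesis by (intro bexI[of _ x] conjI) auto
    qed
    have ?iii
    proof (intro allI impI)
      fix M F and \<epsilon> :: real
      assume M: "lp_closed_fin_codim_subspace p M" and F: "lp_fin_dim_subspace p F" and \<epsilon>: "0 < \<epsilon>"
      obtain B where B: "cseq.subspace M" "finite B" "cseq.span (M \<union> B) = lp_space p"
        using M unfolding lp_closed_fin_codim_subspace_def by blast
      obtain n where n: "\<forall>x\<in>lp_unit_sphere p. seq_supp x \<subseteq> {n..} \<longrightarrow>
          (\<forall>f\<in>F. norm (bracket p f x) \<le> \<epsilon> / 2 * lp_norm p f)"
        using finite_dim_bracket_small_on_tails[OF p F, of "\<epsilon> / 2"] \<epsilon> by auto
      obtain x where x: "x \<in> lp_unit_sphere p" "x \<in> M" "finite (seq_supp x)" "seq_supp x \<subseteq> {n..}"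
        "norm (bracket p (T x) x - l) < \<epsilon>"
        using fin_codim_vector_of_tail_blocks[OF p T tails B \<epsilon>, of n] by blast
      moreover have "pairing_sup p F (duality_map p x) < \<epsilon>"
        using n x(1,4) by (intro pairing_sup_less[OF p F \<epsilon>]) blast
      ultimately show "\<exists>x\<in>lp_unit_sphere p. x \<in> M \<and> finite (seq_supp x) \<and>
          norm (bracket p (T x) x - l) < \<epsilon> \<and> pairing_sup p F (duality_map p x) < \<epsilon>"
        by blast
    qed
    moreover have ?i by (rule ess_num_range_of_tail_blocks[OF p tails])
    ultimately show ?thesis by blast
  qed
  have iii_ii: "?ii" if ?iii
  proof (intro allI impI)
    fix k :: nat and \<epsilon> :: real assume \<epsilon>: "0 < \<epsilon>"
    have "lp_fin_dim_subspace p {0}"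
      unfolding lp_fin_dim_subspace_def
      by (intro conjI exI[of _ "{}"] cseq.span_empty cseq.subspace_single_0) simp_all
    with \<open>?iii\<close> fin_codim_vanishing_initial_coordinates[OF p, of k] \<epsilon>
    obtain x where x: "x \<in> lp_unit_sphere p" "x \<in> {x \<in> lp_space p. \<forall>j\<le>k. x j = 0}" "finite (seq_supp x)"
      "norm (bracket p (T x) x - l) < \<epsilon>" by blast
    then have "seq_supp x \<subseteq> {k + 1..}" by (force simp: seq_supp_def not_less_eq_eq)
    with x show "\<exists>x\<in>lp_unit_sphere p. finite (seq_supp x) \<and> seq_supp x \<subseteq> {k + 1..} \<and>
        norm (bracket p (T x) x - l) < \<epsilon>" by blast
  qed
  show ?thesis
  proof (intro conjI iffI)
    show ?ii if ?i using that by (rule i_ii)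
    show ?i if ?ii using ii_i_iii[OF that] by (rule conjunct1)
    show ?iii if ?i using ii_i_iii[OF i_ii[OF that]] by (rule conjunct2)
    show ?i if ?iii using ii_i_iii[OF iii_ii[OF that]] by (rule conjunct1)
  qed
qed

end
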